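(* Let $\nu \geq 0$ be fixed, and let $Q_\nu$ denote the Legendre function of the second kind of degree $\nu$, defined on $\{z \in \mathbb{C} : \operatorname{Im}(z) \geq 0\}\setminus\{-1,1\}$ as described in the context. Then the function $x \mapsto |Q_\nu(x)|^2$ is absolutely monotone on the interval $(0,1)$ and completely monotone on the interval $(1,\infty)$.
   Context: For $\operatorname{Im}(z) > 0$, the Legendre function of the second kind of degree $\nu$ is given by the absolutely convergent integral $Q_\nu(z) = \exp\left(-i\frac{\pi}{2}(\nu+1)\right)\int_0^\infty \exp(izt)\, j_\nu(t)\, dt$, where $j_\nu$ is the spherical Bessel function of the first kind of order $\nu$. The domain of $Q_\nu$ is taken to be $\{z : \operatorname{Im}(z) \geq 0\}\setminus\{-1,1\}$, with the values on the real axis (in particular on $(-1,1)$, where $Q_\nu$ is complex-valued) obtained by analytically continuing this integral from the upper half-plane (equivalently, as boundary values from the upper half-plane). A function $f$ on an open interval $I$ is completely monotone on $I$ if $(-1)^k f^{(k)}(x) \geq 0$ for all integers $k \geq 0$ and all $x \in I$, and absolutely monotone on $I$ if $f^{(k)}(x) \geq 0$ for all integers $k \geq 0$ and all $x \in I$. *)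

theory Defs
  imports "HOL-Analysis.Analysis"
begin

definition bessel_J :: "real \<Rightarrow> real \<Rightarrow> real" where
  "bessel_J a t = (\<Sum>m. (-1) ^ m / (fact m * Gamma (real m + a + 1)) * (t / 2) ^ (2 * m))
                   * (t / 2) powr a"

definition spherical_bessel_j :: "real \<Rightarrow> real \<Rightarrow> real" where
  "spherical_bessel_j nu t = sqrt (pi / (2 * t)) * bessel_J (nu + 1/2) t"

definition legendre_Q_upper :: "real \<Rightarrow> complex \<Rightarrow> complex" where
  "legendre_Q_upper nu z =
     exp (- \<i> * of_real (pi / 2 * (nu + 1))) *
     integral {0..} (\<lambda>t::real. exp (\<i> * z * of_real t) * of_real (spherical_bessel_j nu t))"

text \<open>Q_nu on Im z \<ge> 0 minus {-1,1}: on the real axis, boundary values from the upper half-plane.\<close>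
definition legendre_Q :: "real \<Rightarrow> complex \<Rightarrow> complex" where
  "legendre_Q nu z =
     (if Im z > 0 then legendre_Q_upper nu z
      else Lim (at z within {w. Im w > 0}) (legendre_Q_upper nu))"

definition absolutely_monotone_on :: "real set \<Rightarrow> (real \<Rightarrow> real) \<Rightarrow> bool" where
  "absolutely_monotone_on I f \<longleftrightarrow>
     (\<forall>k. \<forall>x\<in>I. ((deriv ^^ k) f) differentiable (at x)) \<and>
     (\<forall>k. \<forall>x\<in>I. (deriv ^^ k) f x \<ge> 0)"

definition completely_monotone_on :: "real set \<Rightarrow> (real \<Rightarrow> real) \<Rightarrow> bool" where
  "completely_monotone_on I f \<longleftrightarrow>
     (\<forall>k. \<forall>x\<in>I. ((deriv ^^ k) f) differentiable (at x)) \<and>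
     (\<forall>k. \<forall>x\<in>I. (-1) ^ k * (deriv ^^ k) f x \<ge> 0)"

end

theory Submission
  imports Defs "HOL-Complex_Analysis.Complex_Analysis"
begin

text \<open>
  Poisson's integral for the Bessel function gives
  \<open>Q\<^sub>\<nu>(z) = \<integral> (1 - s\<^sup>2)\<^sup>\<nu> (2 (z + s))\<^sup>-\<^sup>\<nu>\<^sup>-\<^sup>1 ds\<close> over \<open>[-1, 1]\<close>. For \<open>x > 1\<close> and \<open>b > x\<close> the binomial series turns
  this into a power series in \<open>b - x\<close> with nonnegative coefficients; so is its square, which is therefore
  completely monotone.

  For \<open>0 < x < 1\<close> the integral becomes singular at the boundary. Landen's substitution, continued
  analytically, rewrites it as \<open>Q\<^sub>\<nu>(z) = \<rho>\<^sup>\<nu>\<^sup>+\<^sup>1 I(\<rho>\<^sup>2)\<close> with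
  \<open>I(\<kappa>) = \<integral> (1 - c\<^sup>2)\<^sup>\<nu> (1 - \<kappa> (1 - c\<^sup>2))\<^sup>-\<^sup>1\<^sup>/\<^sup>2 dc\<close> and \<open>\<rho> = z - \<i> sqrt (1 - z\<^sup>2)\<close>, and this has a limit with \<open>|\<rho>| = 1\<close>.
  Hence \<open>|Q\<^sub>\<nu>(x)|\<^sup>2 = I(\<rho>\<^sup>2) I(\<rho>\<^sup>-\<^sup>2)\<close>, which is holomorphic in \<open>x\<close> on the unit disc. On the imaginary axis
  \<open>\<rho>\<^sup>2 = - p\<close> is negative, and the product of the two then real integrals is by Tonelli's theorem and
  an elliptic substitution equal to
  \<open>\<integral>\<integral> 2 N\<^sup>\<nu> ((1 + s\<^sup>2) ((1 - N)\<^sup>2 + 4 (1 - x\<^sup>2) N (1 + s\<^sup>2)))\<^sup>-\<^sup>1\<^sup>/\<^sup>2 ds dN\<close>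
  over \<open>s > 0\<close>, \<open>0 < N < 1\<close>. Its binomial expansion in \<open>x\<^sup>2\<close> has nonnegative coefficients, and by the
  identity theorem it represents \<open>|Q\<^sub>\<nu>(x)|\<^sup>2\<close> on \<open>(0, 1)\<close>.
\<close>

subsection \<open>Power series with nonnegative coefficients\<close>

text \<open>The signs \<open>e\<close> and \<open>d\<close> cover series in \<open>x - b\<close> and
  in \<open>b - x\<close> at once. Termwise differentiation returns a series of the same shape with
  \<open>d\<close> replaced by \<open>d * e\<close>, so it can be iterated.\<close>

lemma power_series_has_derivative:
  fixes f :: "real \<Rightarrow> real" and a :: "nat \<Rightarrow> real"
  assumes e: "e * e = 1" and d: "d * d = 1"
    and sums: "\<And>x. 0 < e * (x - b) \<Longrightarrow> e * (x - b) < R \<Longrightarrow> (\<lambda>n. a n * (e * (x - b)) ^ n) sums (d * f x)"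
    and x: "0 < e * (x - b)" "e * (x - b) < R"
  shows "\<exists>f'. (f has_field_derivative f') (at x) \<and>
           (\<lambda>n. diffs a n * (e * (x - b)) ^ n) sums (d * e * f')"
proof -
  \<comment> \<open>The hypothesis speaks of positive arguments below \<open>R\<close> only;
    convergence at a point \<open>s\<close> strictly between \<open>\<bar>t\<bar>\<close> and
    \<open>R\<close> gives it at \<open>t\<close> of any sign.\<close>
  have smb: "summable (\<lambda>n. a n * t ^ n)" if "\<bar>t\<bar> < R" for t
  proof -
    define s where "s = (\<bar>t\<bar> + R) / 2"
    have s: "\<bar>t\<bar> < s" "s < R" "0 < s" using that by (auto simp: s_def)
    moreover have "e * ((b + e * s) - b) = s" using e by (simp add: mult.assoc[symmetric])
    ultimately have "summable (\<lambda>n. a n * s ^ n)"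
      using sums[of "b + e * s"] by (metis sums_summable)
    thus ?thesis by (rule powser_inside) (use s in auto)
  qed
  have "((\<lambda>x. \<Sum>n. a n * x ^ n) has_field_derivative (\<Sum>n. diffs a n * (e * (x - b)) ^ n)) (at (e * (x - b)))"
    by (rule termdiffs_strong'[where K = R]) (use smb x in auto)
  hence D: "((\<lambda>x. d * (\<Sum>n. a n * (e * (x - b)) ^ n)) has_field_derivative
       d * ((\<Sum>n. diffs a n * (e * (x - b)) ^ n) * e)) (at x)"
    by (intro DERIV_cmult DERIV_chain2[where g = "\<lambda>x. e * (x - b)"])
       (auto intro!: derivative_eq_intros)
  have op: "open {x. 0 < e * (x - b) \<and> e * (x - b) < R}"
    by (intro open_Collect_conj open_Collect_less continuous_intros)
  have eq: "d * (\<Sum>n. a n * (e * (y - b)) ^ n) = f y"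
    if "y \<in> {x. 0 < e * (x - b) \<and> e * (x - b) < R}" for y
    using sums[of y] that d by (simp add: sums_iff mult.assoc[symmetric])
  have "(f has_field_derivative d * ((\<Sum>n. diffs a n * (e * (x - b)) ^ n) * e)) (at x)"
    by (rule has_field_derivative_transform_within_open[OF D op _ eq]) (use x in auto)
  moreover have "summable (\<lambda>n. diffs a n * (e * (x - b)) ^ n)"
    by (rule termdiff_converges[where K = R]) (use smb x in auto)
  ultimately show ?thesis
    using d e by (intro exI[of _ "d * ((\<Sum>n. diffs a n * (e * (x - b)) ^ n) * e)"])
       (auto simp: sums_iff algebra_simps)
qed

text \<open>\<open>diffs\<close> shifts the coefficients and multiplies them by positive integers,
  so they stay nonnegative, while each derivative contributes one factor \<open>e\<close>. The
  induction passes from \<open>f\<close> to \<open>deriv f\<close> and therefore generalises over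
  \<open>f\<close>, \<open>a\<close> and \<open>d\<close>. With \<open>e = 1\<close> this yields
  absolute, with \<open>e = -1\<close> complete monotonicity.\<close>

lemma deriv_sign_of_power_series:
  fixes f :: "real \<Rightarrow> real" and a :: "nat \<Rightarrow> real"
  assumes e: "e * e = 1" and d: "d * d = 1" and nonneg: "\<And>n. 0 \<le> a n"
    and sums: "\<And>x. 0 < e * (x - b) \<Longrightarrow> e * (x - b) < R \<Longrightarrow> (\<lambda>n. a n * (e * (x - b)) ^ n) sums (d * f x)"
    and x: "0 < e * (x - b)" "e * (x - b) < R"
  shows "(deriv ^^ k) f differentiable (at x) \<and> 0 \<le> d * e ^ k * (deriv ^^ k) f x"
  using d nonneg sums x
proof (induction k arbitrary: f a d x)
  case (0 f a d x)
  note * = "0.prems"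
  have "f differentiable (at x)"
    using power_series_has_derivative[OF e *(1,3,4,5)] by (auto simp: real_differentiable_def)
  moreover have "0 \<le> d * f x"
    by (rule sums_le[OF _ sums_zero *(3)[OF *(4,5)]]) (use *(2,4) in auto)
  ultimately show ?case by simp
next
  case (Suc k f a d x)
  note * = Suc.prems
  have "(deriv ^^ k) (deriv f) differentiable (at x) \<and> 0 \<le> (d * e) * e ^ k * (deriv ^^ k) (deriv f) x"
  proof (rule Suc.IH)
    show "d * e * (d * e) = 1" using e *(1) by (metis mult.assoc mult.commute mult_1_right)
    show "0 \<le> diffs a n" for n using *(2) by (simp add: diffs_def)
    show "(\<lambda>n. diffs a n * (e * (y - b)) ^ n) sums (d * e * deriv f y)"
      if "0 < e * (y - b)" "e * (y - b) < R" for y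
      using power_series_has_derivative[OF e *(1,3) that] by (auto dest: DERIV_imp_deriv)
  qed fact+
  thus ?case by (simp add: funpow_Suc_right mult_ac del: funpow.simps)
qed

section \<open>Binomial series with negative exponent, and their integrals\<close>

lemma neg_binomial_sums_real:
  fixes z a :: real
  assumes "\<bar>z\<bar> < 1"
  shows "(\<lambda>n. pochhammer a n / fact n * z ^ n) sums (1 - z) powr (-a)"
  using gen_binomial_real[of "-z" "-a"] assms
  by (simp add: gbinomial_pochhammer power_minus[of z] mult_ac)

lemma neg_binomial_sums_complex:
  fixes z a :: complex
  assumes "cmod z < 1"
  shows "(\<lambda>n. pochhammer a n / fact n * z ^ n) sums (1 - z) powr (-a)"
  using gen_binomial_complex[of "-z" "-a"] assms
  by (simp add: gbinomial_pochhammer power_minus[of z] mult_ac)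

lemma pochhammer_nonneg_real: "0 \<le> a \<Longrightarrow> 0 \<le> pochhammer (a::real) n"
  by (simp add: pochhammer_prod prod_nonneg)

text \<open>Since \<open>0 \<le> X \<le> 1\<close>, the binomial expansion is dominated by the
  numerical series at \<open>\<bar>t\<bar>\<close> times the integrable \<open>g\<close>, so sum and
  integral interchange. Its coefficients are visibly nonnegative; this is where the signs on both
  intervals come from.\<close>

lemma binomial_integral_sums:
  fixes g X :: "'a \<Rightarrow> real"
  assumes g: "integrable M g" "\<And>x. 0 \<le> g x" and X[measurable]: "X \<in> borel_measurable M"
    and X01: "\<And>x. 0 \<le> X x" "\<And>x. X x \<le> 1" and a: "0 \<le> a" and t: "\<bar>t\<bar> < 1"
  shows "(\<lambda>n. pochhammer a n / fact n * (\<integral>x. g x * X x ^ n \<partial>M) * t ^ n)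
           sums (\<integral>x. g x * (1 - t * X x) powr (-a) \<partial>M)"
proof -
  define c where "c n = pochhammer a n / fact n" for n
  have c0: "0 \<le> c n" for n using a by (simp add: c_def pochhammer_nonneg_real)
  have c: "(\<lambda>n. c n * z ^ n) sums (1 - z) powr (-a)" if "\<bar>z\<bar> < 1" for z :: real
    using neg_binomial_sums_real[OF that] by (simp add: c_def)
  have [measurable]: "g \<in> borel_measurable M" using g by auto
  have X1: "X x ^ n \<le> 1" for x n using X01 by (simp add: power_le_one)
  have i: "integrable M (\<lambda>x. g x * X x ^ n)" for n
    by (rule Bochner_Integration.integrable_bound[OF g(1)])
       (use g X01 X1 in \<open>auto simp: mult_left_le abs_mult\<close>)
  have tX: "\<bar>t * X x\<bar> < 1" for x
  proof -
    have "\<bar>t * X x\<bar> = \<bar>t\<bar> * X x" using X01 by (simp add: abs_mult)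
    also have "\<dots> \<le> \<bar>t\<bar> * 1" using X01 by (intro mult_left_mono) auto
    finally show ?thesis using t by simp
  qed
  have sx: "(\<lambda>n. g x * (c n * (t * X x) ^ n)) sums (g x * (1 - t * X x) powr (-a))" for x
    by (intro sums_mult c tX)
  have le: "(\<integral>x. g x * X x ^ n \<partial>M) \<le> (\<integral>x. g x \<partial>M)" for n
    by (intro integral_mono i g) (use g X1 in \<open>auto simp: mult_left_le\<close>)
  have ge: "(\<integral>x. g x * X x ^ n \<partial>M) \<ge> 0" for n
    by (intro Bochner_Integration.integral_nonneg) (use g X01 in auto)
  have "(\<lambda>n. \<integral>x. g x * (c n * (t * X x) ^ n) \<partial>M) sums (\<integral>x. (\<Sum>n. g x * (c n * (t * X x) ^ n)) \<partial>M)"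
  proof (rule sums_integral)
    show "integrable M (\<lambda>x. g x * (c n * (t * X x) ^ n))" for n
      using integrable_mult_left[OF i[of n], of "c n * t ^ n"] by (simp add: power_mult_distrib mult_ac)
    have "summable (\<lambda>n. norm (g x * (c n * (t * X x) ^ n)))" for x
    proof -
      have "summable (\<lambda>n. g x * (c n * \<bar>t * X x\<bar> ^ n))"
        using c[of "\<bar>t * X x\<bar>"] tX[of x] by (intro summable_mult) (auto simp: sums_iff)
      thus ?thesis using g c0 by (simp add: abs_mult power_abs)
    qed
    thus "AE x in M. summable (\<lambda>n. norm (g x * (c n * (t * X x) ^ n)))" by simp
    have eq: "(\<integral>x. norm (g x * (c n * (t * X x) ^ n)) \<partial>M) = c n * \<bar>t\<bar> ^ n * (\<integral>x. g x * X x ^ n \<partial>M)" for n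
      using g c0 X01 by (simp add: abs_mult power_abs power_mult_distrib mult_ac flip: integral_mult_right_zero)
    have "summable (\<lambda>n. c n * \<bar>t\<bar> ^ n * (\<integral>x. g x \<partial>M))"
      using c[of "\<bar>t\<bar>"] t by (intro summable_mult2) (auto simp: sums_iff)
    thus "summable (\<lambda>n. \<integral>x. norm (g x * (c n * (t * X x) ^ n)) \<partial>M)"
      unfolding eq by (rule summable_comparison_test') (use c0 le ge in \<open>auto simp: abs_mult intro!: mult_left_mono\<close>)
  qed
  moreover have "(\<integral>x. g x * (c n * (t * X x) ^ n) \<partial>M) = c n * (\<integral>x. g x * X x ^ n \<partial>M) * t ^ n" for n
    by (simp add: power_mult_distrib mult_ac flip: integral_mult_right_zero)
  ultimately show ?thesis using sx by (simp add: sums_iff c_def)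
qed

subsection \<open>Poisson's integral for the spherical Bessel function\<close>

text \<open>The case distinction avoids \<open>0 powr 0 = 0\<close>, which would make the weight discontinuous
  at \<open>s = 1\<close> and \<open>s = -1\<close> for \<open>\<nu> = 0\<close>.\<close>

definition legendre_weight :: "real \<Rightarrow> real \<Rightarrow> real" where
  "legendre_weight nu s = (if nu = 0 then 1 else (1 - s\<^sup>2) powr nu)"

lemma legendre_weight_nonneg [simp]: "0 \<le> legendre_weight nu s"
  by (simp add: legendre_weight_def)

lemma legendre_weight_minus [simp]: "legendre_weight nu (- s) = legendre_weight nu s"
  by (simp add: legendre_weight_def)

lemma legendre_weight_eq_powr: "\<bar>s\<bar> < 1 \<Longrightarrow> legendre_weight nu s = (1 - s\<^sup>2) powr nu"
  using abs_square_less_1[of s] by (simp add: legendre_weight_def)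

lemma legendre_weight_measurable [measurable]: "legendre_weight nu \<in> borel_measurable borel"
  unfolding legendre_weight_def[abs_def] by measurable

lemma continuous_on_legendre_weight:
  "0 \<le> nu \<Longrightarrow> continuous_on {-1..1} (legendre_weight nu)"
proof (cases "nu = 0")
  case False
  assume "0 \<le> nu"
  hence "continuous_on {-1..1} (\<lambda>s::real. (1 - s\<^sup>2) powr nu)"
    using False by (intro continuous_on_powr') (auto intro!: continuous_intros simp: abs_square_le_1 abs_le_iff)
  thus ?thesis using False by (simp add: legendre_weight_def[abs_def])
qed (simp add: legendre_weight_def[abs_def])

lemma continuous_on_legendre_weight' [continuous_intros]:
  fixes f :: "'a::topological_space \<Rightarrow> real"
  assumes "0 \<le> nu" "continuous_on A f" "\<And>x. x \<in> A \<Longrightarrow> f x \<in> {-1..1}"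
  shows "continuous_on A (\<lambda>x. legendre_weight nu (f x))"
  by (rule continuous_on_compose2[OF continuous_on_legendre_weight[OF assms(1)] assms(2)]) (use assms(3) in auto)

text \<open>Weighted integrals occur as Lebesgue integrals, for series and Fubini, and as gauge
  integrals, for parameter derivatives and substitutions; this passes from one form to the
  other.\<close>

lemma
  fixes F :: "real \<Rightarrow> 'a::euclidean_space"
  assumes "0 \<le> nu" "continuous_on {-1..1} F"
  shows integrable_legendre_weight: "integrable lborel (\<lambda>s. (indicator {-1..1} s * legendre_weight nu s) *\<^sub>R F s)"
    and integral_legendre_weight: "(\<integral>s. (indicator {-1..1} s * legendre_weight nu s) *\<^sub>R F s \<partial>lborel) =
          integral {-1..1} (\<lambda>s. legendre_weight nu s *\<^sub>R F s)"
proof -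
  have *: "set_integrable lborel {-1..1} (\<lambda>s. legendre_weight nu s *\<^sub>R F s)"
    by (intro borel_integrable_atLeastAtMost' continuous_intros assms) auto
  from * show "integrable lborel (\<lambda>s. (indicator {-1..1} s * legendre_weight nu s) *\<^sub>R F s)"
    by (simp add: set_integrable_def)
  from set_borel_integral_eq_integral(2)[OF *]
  show "(\<integral>s. (indicator {-1..1} s * legendre_weight nu s) *\<^sub>R F s \<partial>lborel) =
          integral {-1..1} (\<lambda>s. legendre_weight nu s *\<^sub>R F s)"
    by (simp add: set_lebesgue_integral_def)
qed

lemma integral_even_real:
  fixes f :: "real \<Rightarrow> 'a::euclidean_space"
  assumes "\<And>x. f (-x) = f x" "(f has_integral I) {0..a}" "0 \<le> a"
  shows "(f has_integral (2 *\<^sub>R I)) {-a..a}"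
proof -
  have "(f has_integral I) {-a..0}"
    using assms(2) has_integral_reflect_real[of f I a 0] assms(1) by simp
  from has_integral_combine[OF _ _ this assms(2)] assms(3) show ?thesis by (simp add: scaleR_2)
qed

text \<open>The substitution \<open>t = s\<^sup>2\<close> turns Euler's Beta integral into twice the
  moment over \<open>(0, 1)\<close>, and the integrand is even. The open interval keeps squaring
  injective and all bases of powers positive.\<close>

lemma has_integral_legendre_weight_moment:
  assumes nu: "0 \<le> nu"
  shows "((\<lambda>s. legendre_weight nu s * s ^ (2 * m)) has_integral Beta (real m + 1/2) (nu + 1)) {-1..1}"
proof -
  define f :: "real \<Rightarrow> real" where "f t = t powr (real m - 1/2) * (1 - t) powr nu" for t
  have f1: "(f has_integral Beta (real m + 1/2) (nu + 1)) {0<..<1}"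
    using has_integral_Beta_real[of "real m + 1/2" "nu + 1"] nu
    by (simp add: f_def[abs_def] has_integral_Icc_iff_Ioo algebra_simps)
  have im: "(\<lambda>s::real. s\<^sup>2) ` {0<..<1} = {0<..<1}"
  proof (intro equalityI subsetI)
    fix x :: real assume "x \<in> {0<..<1}"
    thus "x \<in> (\<lambda>s::real. s\<^sup>2) ` {0<..<1}" by (intro image_eqI[of _ _ "sqrt x"]) auto
  qed (auto simp: abs_square_less_1 power_less_one_iff)
  have "f absolutely_integrable_on (\<lambda>s. s\<^sup>2) ` {0<..<1} \<and> integral ((\<lambda>s. s\<^sup>2) ` {0<..<1}) f = Beta (real m + 1/2) (nu + 1)"
    unfolding im using f1 by (auto simp: has_integral_iff f_def intro!: nonnegative_absolutely_integrable_1)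
  hence "(\<lambda>s. \<bar>2 * s\<bar> * f (s\<^sup>2)) absolutely_integrable_on {0<..<1} \<and>
         integral {0<..<1} (\<lambda>s. \<bar>2 * s\<bar> * f (s\<^sup>2)) = Beta (real m + 1/2) (nu + 1)"
    by (subst has_absolute_integral_change_of_variables_1')
       (auto intro!: derivative_eq_intros inj_onI simp: power2_eq_iff)
  hence "((\<lambda>s. \<bar>2 * s\<bar> * f (s\<^sup>2)) has_integral Beta (real m + 1/2) (nu + 1)) {0<..<1}"
    using set_lebesgue_integral_eq_integral(1) by (auto simp: has_integral_iff)
  also have "?this \<longleftrightarrow> ((\<lambda>s. 2 * (legendre_weight nu s * s ^ (2 * m))) has_integral Beta (real m + 1/2) (nu + 1)) {0<..<1}"
  proof (rule has_integral_cong)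
    fix s :: real assume s: "s \<in> {0<..<1}"
    have "(s\<^sup>2) powr (real m - 1/2) = s powr (2 * (real m - 1/2))"
      using s by (simp add: powr_powr flip: powr_numeral)
    hence "s * (s\<^sup>2) powr (real m - 1/2) = s powr 1 * s powr (2 * (real m - 1/2))"
      using s by simp
    also have "\<dots> = s powr (real (2 * m))" by (subst powr_add[symmetric]) (simp add: algebra_simps)
    also have "\<dots> = s ^ (2 * m)" by (rule powr_realpow) (use s in auto)
    finally have *: "s * (s\<^sup>2) powr (real m - 1/2) = s ^ (2 * m)" .
    have "\<bar>2 * s\<bar> * f (s\<^sup>2) = 2 * (s * (s\<^sup>2) powr (real m - 1/2)) * (1 - s\<^sup>2) powr nu"
      using s unfolding f_def by (simp only: abs_mult) simp
    thus "\<bar>2 * s\<bar> * f (s\<^sup>2) = 2 * (legendre_weight nu s * s ^ (2 * m))"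
      unfolding * using s by (simp add: legendre_weight_eq_powr)
  qed
  finally have "((\<lambda>s. legendre_weight nu s * s ^ (2 * m)) has_integral (Beta (real m + 1/2) (nu + 1) / 2)) {0..1}"
    using has_integral_divide[of _ _ "{0<..<1}" 2] by (fastforce simp: has_integral_Icc_iff_Ioo)
  from integral_even_real[OF _ this] show ?thesis by simp
qed

lemma Gamma_half_plus_nat: "Gamma (real m + 1/2) = sqrt pi * fact (2 * m) / (4 ^ m * fact m)"
proof (induction m)
  case 0
  show ?case by (simp add: Gamma_one_half_real)
next
  case (Suc m)
  have "Gamma (real (Suc m) + 1/2) = (real m + 1/2) * Gamma (real m + 1/2)"
    using Gamma_plus1[of "real m + 1/2"] nonpos_Ints_nonpos[of "real m + 1/2"] by (fastforce simp: add_ac)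
  also have "\<dots> = sqrt pi * fact (2 * Suc m) / (4 ^ Suc m * fact (Suc m))"
  proof -
    have "fact (2 * Suc m) = (2 * (1 + real m)) * (2 * (real m + 1/2)) * (fact (2 * m) :: real)"
      by (simp add: algebra_simps)
    moreover have "4 ^ Suc m * fact (Suc m) = 2 * (1 + real m) * (2 * (4 ^ m * fact m))" by (simp add: algebra_simps)
    ultimately show ?thesis
      unfolding Suc by (simp add: divide_simps) (simp add: algebra_simps)
  qed
  finally show ?case .
qed

text \<open>Expand the cosine, integrate term by term and insert the moments. The factorial of
  \<open>2 * m\<close> cancels against \<open>Gamma (m + 1/2)\<close>, which leaves the coefficients
  of the Bessel series of order \<open>nu + 1/2\<close>.\<close>

lemma bessel_poisson_sums:
  assumes nu: "0 \<le> nu"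
  shows "(\<lambda>m. (-1) ^ m / (fact m * Gamma (real m + nu + 3/2)) * (t / 2) ^ (2 * m))
     sums (integral {-1..1} (\<lambda>s. legendre_weight nu s * cos (t * s)) / (sqrt pi * Gamma (nu + 1)))"
proof -
  let ?w = "\<lambda>s. indicator {-1..1} s * legendre_weight nu s"
  define c where "c m = (-1) ^ m / fact (2 * m) * t ^ (2 * m)" for m
  have cs: "(\<lambda>m. c m * x ^ (2 * m)) sums cos (t * x)" for x
    using cos_paired[of "t * x"] by (simp add: c_def power_mult_distrib mult_ac)
  have int: "integrable lborel (\<lambda>s. ?w s *\<^sub>R F s)" if "continuous_on {-1..1} F" for F :: "real \<Rightarrow> real"
    using integrable_legendre_weight[OF nu that] .
  \<comment> \<open>The moduli are the even terms of the series of
    \<open>cosh \<bar>t\<bar>\<close>; as \<open>\<bar>s\<bar> \<le> 1\<close> on the support of the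
    weight, they dominate uniformly in \<open>s\<close>.\<close>
  have sumc: "summable (\<lambda>m. \<bar>c m\<bar>)"
  proof -
    have "(\<lambda>n. if even n then \<bar>t\<bar> ^ n / fact n else 0) sums cosh \<bar>t\<bar>"
      using cosh_converges[of "\<bar>t\<bar>"] by (simp add: divide_inverse mult_ac cong: if_cong)
    hence "summable (\<lambda>n. (if even n then \<bar>t\<bar> ^ n / fact n else 0))" by (rule sums_summable)
    hence "summable (\<lambda>n. (if even (2*n) then \<bar>t\<bar> ^ (2*n) / fact (2*n) else 0))"
      by (rule summable_mono_reindex[THEN iffD2, rotated 2]) (auto intro!: strict_monoI simp: image_iff elim!: evenE)
    thus ?thesis by (simp add: c_def abs_mult power_abs)
  qed
  have "(\<lambda>m. \<integral>s. ?w s * (c m * s ^ (2 * m)) \<partial>lborel) sums (\<integral>s. (\<Sum>m. ?w s * (c m * s ^ (2 * m))) \<partial>lborel)"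
  proof (rule sums_integral)
    show "integrable lborel (\<lambda>s. ?w s * (c m * s ^ (2 * m)))" for m
      by (rule int[of "\<lambda>s. c m * s ^ (2 * m)", unfolded real_scaleR_def]) (intro continuous_intros)
    have b: "norm (?w s * (c m * s ^ (2 * m))) \<le> ?w s * \<bar>c m\<bar>" for s m
    proof (cases "s \<in> {-1..1}")
      case True
      hence "\<bar>s\<bar> ^ (2 * m) \<le> 1" by (intro power_le_one) auto
      hence "\<bar>c m\<bar> * \<bar>s\<bar> ^ (2 * m) \<le> \<bar>c m\<bar>" by (intro mult_left_le) auto
      thus ?thesis using True by (simp add: abs_mult power_abs mult_left_mono del: power_mult)
    qed simp
    have "summable (\<lambda>m. norm (?w s * (c m * s ^ (2 * m))))" for s
      by (rule summable_comparison_test'[OF summable_mult[OF sumc]]) (use b in auto)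
    thus "AE s in lborel. summable (\<lambda>m. norm (?w s * (c m * s ^ (2 * m))))" by simp
    have i1: "integrable lborel ?w" using int[of "\<lambda>_. 1"] by simp
    have "(\<integral>s. norm (?w s * (c m * s ^ (2 * m))) \<partial>lborel) \<le> (\<integral>s. ?w s * \<bar>c m\<bar> \<partial>lborel)" for m
      by (intro integral_mono' b integrable_mult_left i1) auto
    hence "norm (\<integral>s. norm (?w s * (c m * s ^ (2 * m))) \<partial>lborel) \<le> (\<integral>s. ?w s \<partial>lborel) * \<bar>c m\<bar>" for m
      by simp
    thus "summable (\<lambda>m. \<integral>s. norm (?w s * (c m * s ^ (2 * m))) \<partial>lborel)"
      by (intro summable_comparison_test'[OF summable_mult[OF sumc]]) auto
  qed
  also have "(\<lambda>s. \<Sum>m. ?w s * (c m * s ^ (2 * m))) = (\<lambda>s. ?w s *\<^sub>R cos (t * s))"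
    using sums_mult[OF cs] by (auto simp: sums_iff fun_eq_iff)
  also have "(\<integral>s. ?w s *\<^sub>R cos (t * s) \<partial>lborel) = integral {-1..1} (\<lambda>s. legendre_weight nu s * cos (t * s))"
    by (subst integral_legendre_weight[OF nu]) (auto intro!: continuous_intros)
  also have "(\<lambda>m. \<integral>s. ?w s * (c m * s ^ (2 * m)) \<partial>lborel) = (\<lambda>m. c m * Beta (real m + 1/2) (nu + 1))"
  proof
    fix m
    have "(\<integral>s. ?w s * (c m * s ^ (2 * m)) \<partial>lborel) = c m * (\<integral>s. ?w s *\<^sub>R (s ^ (2 * m)) \<partial>lborel)"
      by (simp add: mult_ac flip: integral_mult_right_zero)
    also have "(\<integral>s. ?w s *\<^sub>R (s ^ (2 * m)) \<partial>lborel) = Beta (real m + 1/2) (nu + 1)"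
      using has_integral_legendre_weight_moment[OF nu, of m]
      by (subst integral_legendre_weight[OF nu]) (auto intro!: continuous_intros simp: has_integral_iff)
    finally show "(\<integral>s. ?w s * (c m * s ^ (2 * m)) \<partial>lborel) = c m * Beta (real m + 1/2) (nu + 1)" .
  qed
  finally have "(\<lambda>m. c m * Beta (real m + 1/2) (nu + 1) / (sqrt pi * Gamma (nu + 1)))
     sums (integral {-1..1} (\<lambda>s. legendre_weight nu s * cos (t * s)) / (sqrt pi * Gamma (nu + 1)))"
    by (rule sums_divide)
  also have "(\<lambda>m. c m * Beta (real m + 1/2) (nu + 1) / (sqrt pi * Gamma (nu + 1))) =
     (\<lambda>m. (-1) ^ m / (fact m * Gamma (real m + nu + 3/2)) * (t / 2) ^ (2 * m))"
  proof
    fix m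
    define G where "G = Gamma (real m + nu + 3/2)"
    have "Gamma (nu + 1) \<noteq> 0" "G \<noteq> 0"
      using nu by (auto simp: G_def Gamma_eq_zero_iff nonpos_Ints_def)
    moreover have "real m + 1/2 + (nu + 1) = real m + nu + 3/2" by simp
    hence "Gamma (real m + 1/2 + (nu + 1)) = G" by (simp only: G_def)
    ultimately show "c m * Beta (real m + 1/2) (nu + 1) / (sqrt pi * Gamma (nu + 1)) =
      (-1) ^ m / (fact m * Gamma (real m + nu + 3/2)) * (t / 2) ^ (2 * m)"
      unfolding c_def Beta_def Gamma_half_plus_nat power_mult power_divide G_def[symmetric]
      by (simp add: divide_simps)
  qed
  finally show ?thesis .
qed

lemma spherical_bessel_j_poisson:
  assumes nu: "0 \<le> nu" and t: "0 < t"
  shows "spherical_bessel_j nu t = t powr nu / (2 powr (nu + 1) * Gamma (nu + 1)) *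
           integral {-1..1} (\<lambda>s. legendre_weight nu s * cos (t * s))"
proof -
  let ?I = "integral {-1..1} (\<lambda>s. legendre_weight nu s * cos (t * s))"
  have "bessel_J (nu + 1/2) t = ?I / (sqrt pi * Gamma (nu + 1)) * (t / 2) powr (nu + 1/2)"
    using bessel_poisson_sums[OF nu, of t] by (simp add: bessel_J_def sums_iff add_ac)
  moreover have "sqrt (pi / (2 * t)) * (t / 2) powr (nu + 1/2) = sqrt pi * (t powr nu / 2 powr (nu + 1))"
  proof -
    have "sqrt (pi / (2 * t)) * (t / 2) powr (nu + 1/2) = (t / 2) powr nu * (sqrt (pi / (2 * t)) * sqrt (t / 2))"
      using t by (simp add: powr_add powr_half_sqrt)
    also have "sqrt (pi / (2 * t)) * sqrt (t / 2) = sqrt (pi / 4)"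
      using t by (simp flip: real_sqrt_mult)
    also have "sqrt (pi / 4) = sqrt pi / 2" by (simp add: real_sqrt_divide)
    finally show ?thesis using t by (simp add: powr_divide powr_add)
  qed
  moreover have "spherical_bessel_j nu t = (sqrt (pi / (2 * t)) * (t / 2) powr (nu + 1/2)) * (?I / (sqrt pi * Gamma (nu + 1)))"
    unfolding spherical_bessel_j_def calculation(1) by (simp only: mult_ac)
  ultimately show ?thesis by simp
qed

subsection \<open>The Legendre function in the upper half-plane\<close>

text \<open>Rescaling \<open>t\<close> in the Gamma integral, done for the nonnegative integral so
  that integrability and value come out together.\<close>

lemma gamma_kernel_real:
  fixes a c :: real
  assumes a: "0 < a" and c: "0 < c"
  shows "integrable lborel (\<lambda>t. indicator {0..} t * t powr (a - 1) * exp (- c * t))"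
    and "(\<integral>t. indicator {0..} t * t powr (a - 1) * exp (- c * t) \<partial>lborel) = Gamma a / c powr a"
proof -
  have G: "0 < Gamma a" using a by simp
  have "ennreal (Gamma a) = (\<integral>\<^sup>+t. ennreal (indicator {0..} t * t powr (a - 1) / exp t) \<partial>lborel)"
    by (rule Gamma_conv_nn_integral_real[OF a])
  also have "\<dots> = \<bar>c\<bar> * (\<integral>\<^sup>+t. ennreal (indicator {0..} (0 + c * t) * (0 + c * t) powr (a - 1) / exp (0 + c * t)) \<partial>lborel)"
    by (subst nn_integral_real_affine[where c = c and t = 0]) (use c in auto)
  also have "(\<lambda>t. ennreal (indicator {0..} (0 + c * t) * (0 + c * t) powr (a - 1) / exp (0 + c * t))) =
     (\<lambda>t. ennreal (c powr (a - 1)) * ennreal (indicator {0..} t * t powr (a - 1) * exp (- c * t)))"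
    using c by (auto simp: fun_eq_iff indicator_def zero_le_mult_iff powr_mult exp_minus field_simps simp flip: ennreal_mult')
  also have "\<bar>c\<bar> * (\<integral>\<^sup>+t. ennreal (c powr (a - 1)) * ennreal (indicator {0..} t * t powr (a - 1) * exp (- c * t)) \<partial>lborel) =
     ennreal (c powr a) * (\<integral>\<^sup>+t. ennreal (indicator {0..} t * t powr (a - 1) * exp (- c * t)) \<partial>lborel)"
  proof (subst nn_integral_cmult)
    have "c * c powr (a - 1) = c powr a" using c by (simp add: powr_diff)
    thus "\<bar>c\<bar> * (ennreal (c powr (a - 1)) * (\<integral>\<^sup>+t. ennreal (indicator {0..} t * t powr (a - 1) * exp (- c * t)) \<partial>lborel)) =
     ennreal (c powr a) * (\<integral>\<^sup>+t. ennreal (indicator {0..} t * t powr (a - 1) * exp (- c * t)) \<partial>lborel)"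
      using c by (simp add: mult.assoc[symmetric] flip: ennreal_mult')
  qed auto
  finally have *: "ennreal (c powr a) * (\<integral>\<^sup>+t. ennreal (indicator {0..} t * t powr (a - 1) * exp (- c * t)) \<partial>lborel) = ennreal (Gamma a)" ..
  have "(\<integral>\<^sup>+t. ennreal (indicator {0..} t * t powr (a - 1) * exp (- c * t)) \<partial>lborel) =
    ennreal (inverse (c powr a)) * (ennreal (c powr a) * (\<integral>\<^sup>+t. ennreal (indicator {0..} t * t powr (a - 1) * exp (- c * t)) \<partial>lborel))"
    using c by (simp add: mult.assoc[symmetric] flip: ennreal_mult')
  also have "\<dots> = ennreal (Gamma a / c powr a)"
    unfolding * using c G by (simp add: divide_inverse mult.commute flip: ennreal_mult')
  finally have "(\<integral>\<^sup>+t. ennreal (indicator {0..} t * t powr (a - 1) * exp (- c * t)) \<partial>lborel) = ennreal (Gamma a / c powr a)" .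
  thus "integrable lborel (\<lambda>t. indicator {0..} t * t powr (a - 1) * exp (- c * t))"
    and "(\<integral>t. indicator {0..} t * t powr (a - 1) * exp (- c * t) \<partial>lborel) = Gamma a / c powr a"
    by (subst (asm) nn_integral_eq_integrable; use G in simp)+
qed

text \<open>Expanding about a real \<open>c\<close> with \<open>cmod (c - p) < c\<close> reduces the complex rate \<open>p\<close> to the
  Gamma integral and the binomial series.\<close>

lemma gamma_kernel_complex:
  fixes nu :: real and p :: complex
  assumes nu: "0 \<le> nu" and p: "0 < Re p"
  shows "integrable lborel (\<lambda>t. (indicator {0..} t * t powr nu) *\<^sub>R exp (- p * of_real t))"
    and "(\<integral>t. (indicator {0..} t * t powr nu) *\<^sub>R exp (- p * of_real t) \<partial>lborel) =
           of_real (Gamma (nu + 1)) * p powr (- of_real (nu + 1))"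
proof -
  let ?k = "\<lambda>t::real. indicator {0..} t * t powr nu :: real"
  have p0: "p \<noteq> 0" using p by auto
  have intk: "integrable lborel (\<lambda>t. ?k t * exp (- c * t))" if "0 < c" for c
    using gamma_kernel_real(1)[of "nu + 1" c] nu that by simp
  show "integrable lborel (\<lambda>t. ?k t *\<^sub>R exp (- p * of_real t))"
    by (rule Bochner_Integration.integrable_bound[OF intk[OF p]]) auto
  \<comment> \<open>Chosen so that \<open>2 * Re p * c = (cmod p)\<^sup>2 + 1\<close>, which makes
    \<open>(cmod (c - p))\<^sup>2\<close> equal to \<open>c\<^sup>2 - 1\<close>.\<close>
  define c where "c = ((cmod p)\<^sup>2 + 1) / (2 * Re p)"
  define q where "q = of_real c - p"
  have c: "0 < c" using p by (simp add: c_def divide_pos_pos add_nonneg_pos)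
  have qc: "cmod q < c"
  proof -
    have "2 * Re p * c = (cmod p)\<^sup>2 + 1" using p by (simp add: c_def)
    moreover have "(cmod q)\<^sup>2 = (c - Re p)\<^sup>2 + (Im p)\<^sup>2" "(cmod p)\<^sup>2 = (Re p)\<^sup>2 + (Im p)\<^sup>2"
      by (simp_all add: q_def cmod_power2)
    ultimately have "(cmod q)\<^sup>2 < c\<^sup>2" by (simp add: power2_eq_square algebra_simps)
    thus ?thesis using c by (simp add: power_less_imp_less_base)
  qed
  \<comment> \<open>The Gamma integrand with \<open>t ^ n\<close> absorbed into the exponent; its
    integral produces the Pochhammer symbol of the binomial series.\<close>
  let ?r = "\<lambda>(n::nat) t. indicator {0..} t * t powr (nu + real n + 1 - 1) * exp (- c * t) :: real"
  have r: "integrable lborel (?r n)" "(\<integral>t. ?r n t \<partial>lborel) = Gamma (nu + real n + 1) / c powr (nu + real n + 1)" for n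
    using gamma_kernel_real[of "nu + real n + 1" c] nu c by auto
  have pg: "Gamma (nu + real n + 1) / c powr (nu + real n + 1) / fact n =
      Gamma (nu + 1) / c powr (nu + 1) * (pochhammer (nu + 1) n / fact n * (1 / c) ^ n)" for n
  proof -
    have "nu + 1 \<notin> \<int>\<^sub>\<le>\<^sub>0" using nu nonpos_Ints_nonpos[of "nu + 1"] by auto
    hence "Gamma (nu + real n + 1) = pochhammer (nu + 1) n * Gamma (nu + 1)"
      using pochhammer_Gamma[of "nu + 1" n] nu by (simp add: add_ac Gamma_eq_zero_iff)
    moreover have "c powr (nu + real n + 1) = c powr (nu + 1) * c ^ n"
    proof -
      have "c powr (nu + real n + 1) = c powr (nu + 1) * c powr real n"
        by (subst powr_add[symmetric]) (simp add: add_ac)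
      thus ?thesis using c by (simp add: powr_realpow)
    qed
    ultimately show ?thesis by (simp add: power_divide mult_ac)
  qed
  define f where "f n t = (q ^ n / fact n) * of_real (?r n t)" for n t
  note bin = neg_binomial_sums_real[of _ "nu + 1"]
  have binc: "(\<lambda>n. of_real (pochhammer (nu + 1) n / fact n) * z ^ n) sums (1 - z) powr (- of_real (nu + 1))"
    if "cmod z < 1" for z :: complex
    using neg_binomial_sums_complex[OF that, of "of_real (nu + 1)"] unfolding pochhammer_of_real by simp
  \<comment> \<open>Here \<open>f n\<close> is the n-th term of \<open>exp (q t)\<close>, multiplied
    by \<open>exp (- c t)\<close> and the kernel. For \<open>t \<le> 0\<close> both sides vanish, at
    \<open>t = 0\<close> because \<open>0 powr a = 0\<close> for every \<open>a\<close>.\<close>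
  have ff: "f n t = ?k t *\<^sub>R (exp (- of_real (c * t)) * ((q * of_real t) ^ n /\<^sub>R fact n))" for n t
    by (cases "t \<le> 0") (auto simp: f_def powr_add powr_realpow scaleR_conv_of_real power_mult_distrib
          exp_of_real[symmetric] divide_inverse indicator_def)
  have fs: "(\<lambda>n. f n t) sums (?k t *\<^sub>R exp (- p * of_real t))" for t
  proof -
    have "(\<lambda>n. ?k t *\<^sub>R (exp (- of_real (c * t)) * ((q * of_real t) ^ n /\<^sub>R fact n))) sums
       (?k t *\<^sub>R (exp (- of_real (c * t)) * exp (q * of_real t)))"
      by (intro sums_scaleR_right sums_mult exp_converges)
    also have "exp (- of_real (c * t)) * exp (q * of_real t) = exp (- p * of_real t)"
      by (simp add: q_def algebra_simps flip: exp_add)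
    finally show ?thesis unfolding ff .
  qed
  have "(\<lambda>n. \<integral>t. f n t \<partial>lborel) sums (\<integral>t. (\<Sum>n. f n t) \<partial>lborel)"
  proof (rule sums_integral)
    show "integrable lborel (f n)" for n
      unfolding f_def[abs_def] using r(1)[of n] by (intro integrable_mult_right integrable_of_real)
    have "summable (\<lambda>n. norm (f n t))" for t
      unfolding ff norm_scaleR norm_mult
      by (intro summable_mult) (use summable_norm_exp[of "q * of_real t"] in simp)
    thus "AE t in lborel. summable (\<lambda>n. norm (f n t))" by simp
    have "(\<integral>t. norm (f n t) \<partial>lborel) =
        Gamma (nu + 1) / c powr (nu + 1) * (pochhammer (nu + 1) n / fact n * (cmod q / c) ^ n)" for n
    proof -
      have "(\<integral>t. norm (f n t) \<partial>lborel) = (cmod q ^ n / fact n) * (\<integral>t. ?r n t \<partial>lborel)"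
        by (simp add: f_def norm_mult norm_divide norm_power abs_mult flip: integral_mult_right_zero)
      also have "\<dots> = cmod q ^ n * (Gamma (nu + real n + 1) / c powr (nu + real n + 1) / fact n)"
        unfolding r(2) by simp
      finally show ?thesis unfolding pg by (simp add: power_divide mult_ac)
    qed
    note e1 = this
    show "summable (\<lambda>n. \<integral>t. norm (f n t) \<partial>lborel)"
      unfolding e1 by (intro summable_mult sums_summable[OF bin]) (use qc c in auto)
  qed
  moreover have "(\<integral>t. f n t \<partial>lborel) = of_real (Gamma (nu + 1) / c powr (nu + 1)) *
      (of_real (pochhammer (nu + 1) n / fact n) * (q / of_real c) ^ n)" for n
  proof -
    have "(\<integral>t. f n t \<partial>lborel) = (q ^ n / fact n) * of_real (\<integral>t. ?r n t \<partial>lborel)"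
      unfolding f_def by (simp only: integral_mult_right_zero integral_complex_of_real)
    also have "\<dots> = q ^ n * of_real (Gamma (nu + real n + 1) / c powr (nu + real n + 1) / fact n)"
      unfolding r(2) by simp
    finally have "(\<integral>t. f n t \<partial>lborel) = q ^ n * of_real (Gamma (nu + real n + 1) / c powr (nu + real n + 1) / fact n)" .
    thus ?thesis unfolding pg by (simp add: power_divide)
  qed
  moreover have "(\<lambda>n. of_real (Gamma (nu + 1) / c powr (nu + 1)) *
      (of_real (pochhammer (nu + 1) n / fact n) * (q / of_real c) ^ n)) sums
      (of_real (Gamma (nu + 1) / c powr (nu + 1)) * (1 - q / of_real c) powr (- of_real (nu + 1)))"
    using qc c by (intro sums_mult binc) (simp add: norm_divide)
  ultimately have "(\<integral>t. ?k t *\<^sub>R exp (- p * of_real t) \<partial>lborel) =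
      of_real (Gamma (nu + 1) / c powr (nu + 1)) * (1 - q / of_real c) powr (- of_real (nu + 1))"
    using fs by (simp add: sums_iff)
  also have "1 - q / of_real c = p / of_real c" using c by (simp add: q_def field_simps)
  \<comment> \<open>Division by a positive real leaves the argument unchanged, so the principal
    power of the quotient splits.\<close>
  also have "(p / of_real c) powr (- of_real (nu + 1)) = p powr (- of_real (nu + 1)) * of_real (c powr (nu + 1))"
  proof -
    have "complex_of_real (c powr (nu + 1)) = exp (of_real (nu + 1) * of_real (ln c))"
      using c exp_of_real[of "(nu + 1) * ln c", where 'a = complex] by (simp add: powr_def)
    thus ?thesis using c p0 by (simp add: powr_def Ln_divide_of_real algebra_simps flip: exp_add)
  qed
  finally show "(\<integral>t. ?k t *\<^sub>R exp (- p * of_real t) \<partial>lborel) =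
           of_real (Gamma (nu + 1)) * p powr (- of_real (nu + 1))"
    using c by simp
qed

text \<open>The weight is even, so the integrals of the two exponentials agree by reflection, and
  their sum is twice the cosine integral.\<close>

lemma legendre_weight_cos_exp:
  assumes nu: "0 \<le> nu"
  shows "complex_of_real (integral {-1..1} (\<lambda>s. legendre_weight nu s * cos (t * s))) =
    (\<integral>s. (indicator {-1..1} s * legendre_weight nu s) *\<^sub>R exp (\<i> * of_real (s * t)) \<partial>lborel)"
proof -
  let ?I = "integral {-1..1} (\<lambda>s. legendre_weight nu s *\<^sub>R exp (\<i> * of_real (s * t)))"
  let ?J = "integral {-1..1} (\<lambda>s. legendre_weight nu s *\<^sub>R exp (- \<i> * of_real (s * t)))"
  have "?J = ?I"
    using Henstock_Kurzweil_Integration.integral_reflect_real[of 1 "-1" "\<lambda>s. legendre_weight nu s *\<^sub>R exp (\<i> * of_real (s * t))"]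
    by simp
  moreover have "?I + ?J = integral {-1..1} (\<lambda>s. legendre_weight nu s *\<^sub>R exp (\<i> * of_real (s * t)) + legendre_weight nu s *\<^sub>R exp (- \<i> * of_real (s * t)))"
    by (subst Henstock_Kurzweil_Integration.integral_add)
       (auto intro!: integrable_continuous_real continuous_intros nu)
  moreover have "\<dots> = integral {-1..1} (\<lambda>s. 2 * complex_of_real (legendre_weight nu s * cos (t * s)))"
    by (intro Henstock_Kurzweil_Integration.integral_cong)
       (simp add: cos_exp_eq scaleR_conv_of_real algebra_simps flip: cos_of_real)
  moreover have "\<dots> = 2 * complex_of_real (integral {-1..1} (\<lambda>s. legendre_weight nu s * cos (t * s)))"
  proof -
    have "((\<lambda>s. legendre_weight nu s * cos (t * s)) has_integral integral {-1..1} (\<lambda>s. legendre_weight nu s * cos (t * s))) {-1..1}"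
      by (intro integrable_integral integrable_continuous_real continuous_intros nu) auto
    thus ?thesis
      by (intro integral_unique has_integral_mult_right has_integral_of_real)
  qed
  ultimately show ?thesis
    by (subst integral_legendre_weight[OF nu]) (auto intro!: continuous_intros)
qed

text \<open>The argument of \<open>z\<close> lies in \<open>(0, pi)\<close>, so the factor
  \<open>- \<i>\<close> shifts it by \<open>- pi / 2\<close> inside the principal range. This
  absorbs the phase in the definition of the Legendre function and the power of two in Poisson's
  formula.\<close>

lemma powr_phase:
  assumes z: "0 < Im z"
  shows "exp (- \<i> * of_real (pi / 2 * a)) * (of_real (inverse (2 powr a)) * (- \<i> * z) powr (- of_real a)) = (2 * z) powr (- of_real a)"
proof -
  have z0: "z \<noteq> 0" using z by auto
  have "Ln (- \<i> * z) = Ln (- \<i>) + Ln z"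
    using Im_Ln_pos_lt_imp[OF z] z0 by (intro Ln_times_simple) auto
  hence 1: "(- \<i> * z) powr (- of_real a) = exp (- of_real a * (Ln z - \<i> * of_real pi / 2))"
    using z0 by (simp add: powr_def)
  have 2: "(2 * z) powr (- of_real a) = exp (- of_real a * (of_real (ln 2) + Ln z))"
    using Ln_times_of_real[of 2 z] z0 Ln_of_real[of 2] by (simp add: powr_def)
  have 3: "of_real (inverse (2 powr a)) = exp (- complex_of_real (a * ln 2))"
    by (simp add: powr_def exp_minus flip: exp_of_real)
  show ?thesis
    unfolding 1 2 3 exp_add[symmetric] by (simp add: algebra_simps)
qed

text \<open>Fubini for \<open>F t s\<close>, whose modulus is a product of integrable functions of
  \<open>t\<close> and \<open>s\<close> because the exponential has modulus
  \<open>exp (- Im z * t)\<close>. Integrating over \<open>s\<close> first gives the defining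
  integral by Poisson's formula, over \<open>t\<close> first a power by the Gamma integral.\<close>

lemma legendre_Q_upper_eq:
  assumes nu: "0 \<le> nu" and z: "0 < Im z"
  shows "legendre_Q_upper nu z = integral {-1..1} (\<lambda>s. legendre_weight nu s *\<^sub>R (2 * (z + of_real s)) powr (- of_real (nu + 1)))"
proof -
  let ?w = "\<lambda>s. indicator {-1..1} s * legendre_weight nu s :: real"
  let ?k = "\<lambda>t::real. indicator {0..} t * t powr nu :: real"
  define K where "K = inverse (2 powr (nu + 1) * Gamma (nu + 1))"
  define F where "F = (\<lambda>t s. (?k t * ?w s) *\<^sub>R exp (- (- \<i> * (z + of_real s)) * of_real t))"
  have nF: "norm (F t s) = (?k t * exp (- Im z * t)) * ?w s" for t s
    by (simp add: F_def)
  have [measurable]: "case_prod F \<in> borel_measurable (lborel \<Otimes>\<^sub>M lborel)"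
    unfolding F_def by measurable
  have iw: "integrable lborel ?w"
    using integrable_legendre_weight[OF nu, of "\<lambda>_. 1::real"] by simp
  have ik: "integrable lborel (\<lambda>t. ?k t * exp (- Im z * t))"
    using gamma_kernel_real(1)[of "nu + 1" "Im z"] nu z by simp
  have intF: "integrable (lborel \<Otimes>\<^sub>M lborel) (case_prod F)"
  proof (rule lborel_pair.Fubini_integrable)
    show "integrable lborel (\<lambda>t. \<integral>s. norm (case_prod F (t, s)) \<partial>lborel)"
      unfolding split nF integral_mult_right_zero by (rule integrable_mult_left[OF ik])
    have "integrable lborel (\<lambda>s. F t s)" for t
    proof (rule Bochner_Integration.integrable_bound)
      show "integrable lborel (\<lambda>s. (?k t * exp (- Im z * t)) * ?w s)" using iw by (rule integrable_mult_right)
    qed (simp_all only: nF, auto)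
    thus "AE t in lborel. integrable lborel (\<lambda>s. case_prod F (t, s))" by simp
  qed simp
  have inner_s: "(\<integral>s. F t s \<partial>lborel) * of_real K = indicator {0..} t *\<^sub>R (exp (\<i> * z * of_real t) * of_real (spherical_bessel_j nu t))" for t
  proof (cases "t > 0")
    case True
    have "(\<integral>s. F t s \<partial>lborel) = (\<integral>s. (of_real (t powr nu) * exp (\<i> * z * of_real t)) * (?w s *\<^sub>R exp (\<i> * of_real (s * t))) \<partial>lborel)"
      using True by (intro Bochner_Integration.integral_cong) (auto simp: F_def scaleR_conv_of_real algebra_simps exp_add)
    also have "\<dots> = (of_real (t powr nu) * exp (\<i> * z * of_real t)) * of_real (integral {-1..1} (\<lambda>s. legendre_weight nu s * cos (t * s)))"
      by (simp only: integral_mult_right_zero legendre_weight_cos_exp[OF nu])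
    finally show ?thesis using True spherical_bessel_j_poisson[OF nu True]
      by (simp add: K_def divide_inverse mult_ac)
  \<comment> \<open>At \<open>t = 0\<close> both sides are \<open>0\<close>: on the left
    \<open>0 powr nu = 0\<close>, on the right \<open>pi / 0 = 0\<close> under the square
    root.\<close>
  qed (auto simp: F_def indicator_def spherical_bessel_j_def)
  have inner_t: "(\<integral>t. F t s \<partial>lborel) = ?w s *\<^sub>R (of_real (Gamma (nu + 1)) * (- \<i> * (z + of_real s)) powr (- of_real (nu + 1)))" for s
  proof -
    have "(\<integral>t. F t s \<partial>lborel) = (\<integral>t. ?w s *\<^sub>R (?k t *\<^sub>R exp (- (- \<i> * (z + of_real s)) * of_real t)) \<partial>lborel)"
      by (simp add: F_def mult_ac)
    also have "\<dots> = ?w s *\<^sub>R (of_real (Gamma (nu + 1)) * (- \<i> * (z + of_real s)) powr (- of_real (nu + 1)))"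
      unfolding integral_scaleR_right by (subst gamma_kernel_complex[OF nu]) (use z in auto)
    finally show ?thesis .
  qed
  have "integrable lborel (\<lambda>t. \<integral>s. F t s \<partial>lborel)"
    using lborel_pair.integrable_fst'[OF intF] by simp
  hence "integrable lborel (\<lambda>t. (\<integral>s. F t s \<partial>lborel) * of_real K)" by (rule integrable_mult_left)
  hence si: "set_integrable lborel {0..} (\<lambda>t. exp (\<i> * z * of_real t) * of_real (spherical_bessel_j nu t))"
    unfolding inner_s set_integrable_def .
  have "integral {0..} (\<lambda>t. exp (\<i> * z * of_real t) * of_real (spherical_bessel_j nu t)) = (\<integral>t. (\<integral>s. F t s \<partial>lborel) * of_real K \<partial>lborel)"
    using set_borel_integral_eq_integral(2)[OF si] unfolding set_lebesgue_integral_def inner_s by simp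
  also have "\<dots> = (\<integral>s. (\<integral>t. F t s \<partial>lborel) \<partial>lborel) * of_real K"
    using lborel_pair.Fubini_integral[OF intF] by simp
  finally have "legendre_Q_upper nu z = exp (- \<i> * of_real (pi / 2 * (nu + 1))) * ((\<integral>s. (\<integral>t. F t s \<partial>lborel) \<partial>lborel) * of_real K)"
    unfolding legendre_Q_upper_def by simp
  also have "\<dots> = (\<integral>s. exp (- \<i> * of_real (pi / 2 * (nu + 1))) * ((\<integral>t. F t s \<partial>lborel) * of_real K) \<partial>lborel)"
    by (simp only: integral_mult_right_zero integral_mult_left_zero)
  also have "\<dots> = (\<integral>s. ?w s *\<^sub>R (2 * (z + of_real s)) powr (- of_real (nu + 1)) \<partial>lborel)"
  proof (rule Bochner_Integration.integral_cong[OF refl])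
    fix s :: real
    have "0 < Gamma (nu + 1)" using nu by (intro Gamma_real_pos) simp
    hence G: "Gamma (nu + 1) \<noteq> 0" by simp
    have zs: "0 < Im (z + of_real s)" using z by simp
    show "exp (- \<i> * of_real (pi / 2 * (nu + 1))) * ((\<integral>t. F t s \<partial>lborel) * of_real K) = ?w s *\<^sub>R (2 * (z + of_real s)) powr (- of_real (nu + 1))"
      unfolding inner_t powr_phase[OF zs, symmetric] K_def using G by (simp add: scaleR_conv_of_real)
  qed
  also have "\<dots> = integral {-1..1} (\<lambda>s. legendre_weight nu s *\<^sub>R (2 * (z + of_real s)) powr (- of_real (nu + 1)))"
    by (rule integral_legendre_weight[OF nu])
       (use z in \<open>auto intro!: continuous_intros simp: complex_nonpos_Reals_iff complex_eq_iff\<close>)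
  finally show ?thesis .
qed

subsection \<open>Landen's transformation\<close>

text \<open>With \<open>c = cos \<theta>\<close> this integrates \<open>sin \<theta> powr (2 * nu +
  1) * (1 - \<kappa> * (sin \<theta>)\<^sup>2) powr (-1/2)\<close> from \<open>0\<close> to
  \<open>pi\<close>. Formally, \<open>nu = -1/2\<close> is twice the complete elliptic integral of
  the first kind with parameter \<open>\<kappa>\<close>.\<close>

definition legendre_I :: "real \<Rightarrow> complex \<Rightarrow> complex" where
  "legendre_I nu \<kappa> = integral {-1..1} (\<lambda>c. legendre_weight nu c *\<^sub>R (1 - \<kappa> * of_real (1 - c\<^sup>2)) powr (-1/2))"

text \<open>If the base were a real \<open>r \<le> 0\<close>, then
  \<open>\<kappa> = (1 - r) / (1 - c\<^sup>2)\<close> would be real and at least \<open>1\<close>.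
  Off that slit the principal power is holomorphic for every \<open>c\<close>.\<close>

lemma legendre_I_base_not_nonpos:
  fixes \<kappa> :: complex
  assumes "c \<in> {-1..1}" "\<And>x. 1 \<le> x \<Longrightarrow> \<kappa> \<noteq> of_real x"
  shows "1 - \<kappa> * of_real (1 - c\<^sup>2) \<notin> \<real>\<^sub>\<le>\<^sub>0"
proof
  assume "1 - \<kappa> * of_real (1 - c\<^sup>2) \<in> \<real>\<^sub>\<le>\<^sub>0"
  then obtain r where r: "r \<le> 0" "1 - \<kappa> * of_real (1 - c\<^sup>2) = of_real r" by (auto elim: nonpos_Reals_cases)
  have c: "0 \<le> c\<^sup>2" "c\<^sup>2 \<le> 1" using assms(1) by (auto simp: abs_square_le_1 abs_le_iff)
  have k: "\<kappa> * of_real (1 - c\<^sup>2) = of_real (1 - r)" using r(2) by (simp add: algebra_simps)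
  have "1 - c\<^sup>2 \<noteq> 0" using k r(1) by (auto simp del: of_real_diff)
  hence "1 - c\<^sup>2 > 0" using c by simp
  hence "\<kappa> = of_real ((1 - r) / (1 - c\<^sup>2))"
    using k unfolding of_real_divide by (subst nonzero_eq_divide_eq) (auto simp del: of_real_diff)
  moreover have "1 \<le> (1 - r) / (1 - c\<^sup>2)" using \<open>1 - c\<^sup>2 > 0\<close> r(1) c(1) by (subst le_divide_eq_1_pos) linarith+
  ultimately show False using assms(2) by blast
qed

lemma continuous_on_powr_const_complex:
  fixes f :: "'a::topological_space \<Rightarrow> complex"
  assumes "continuous_on A f" "\<And>x. x \<in> A \<Longrightarrow> f x \<notin> \<real>\<^sub>\<le>\<^sub>0"
  shows "continuous_on A (\<lambda>x. f x powr c)"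
  by (rule continuous_on_compose2[of "- \<real>\<^sub>\<le>\<^sub>0" "\<lambda>z. z powr c"])
     (use assms in \<open>auto intro!: holomorphic_on_imp_continuous_on holomorphic_intros\<close>)

lemma open_slit_plane: "open (- complex_of_real ` {1..})"
proof -
  have eq: "complex_of_real ` {1..} = {z. Im z = 0} \<inter> {z. 1 \<le> Re z}"
    by (auto simp: complex_eq_iff image_iff)
  show ?thesis
    unfolding eq by (intro open_Compl closed_Int closed_Collect_eq closed_Collect_le continuous_intros)
qed

text \<open>Differentiation under the integral sign is applied on balls, as the slit plane is not
  convex; holomorphy is local.\<close>

lemma legendre_I_holomorphic:
  assumes nu: "0 \<le> nu"
  shows "legendre_I nu holomorphic_on (- of_real ` {1..})"
proof -
  note op = open_slit_plane
  have "legendre_I nu analytic_on (- of_real ` {1..})"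
    unfolding analytic_on_def
  proof
    fix z :: complex assume "z \<in> - of_real ` {1..}"
    then obtain e where e: "0 < e" "ball z e \<subseteq> - of_real ` {1..}"
      using op by (meson open_contains_ball)
    have *: "1 - x * of_real (1 - c\<^sup>2) \<notin> \<real>\<^sub>\<le>\<^sub>0" if "x \<in> ball z e" "c \<in> {-1..1}" for x and c :: real
      by (rule legendre_I_base_not_nonpos) (use that e in auto)
    have "legendre_I nu holomorphic_on ball z e"
      unfolding legendre_I_def[abs_def] interval_cbox
    proof (rule leibniz_rule_holomorphic)
      fix x c assume xc: "x \<in> ball z e" "c \<in> cbox (-1) (1::real)"
      show "((\<lambda>x. legendre_weight nu c *\<^sub>R (1 - x * of_real (1 - c\<^sup>2)) powr (- 1 / 2)) has_field_derivative
         legendre_weight nu c *\<^sub>R ((1 - x * of_real (1 - c\<^sup>2)) powr (-3/2) * (of_real (1 - c\<^sup>2) / 2))) (at x within ball z e)"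
        unfolding scaleR_conv_of_real
        by (rule has_field_derivative_at_within, rule DERIV_cmult)
           (use *[of x c] xc in \<open>auto intro!: derivative_eq_intros simp: field_simps\<close>)
    next
      fix x assume "x \<in> ball z e"
      thus "(\<lambda>c. legendre_weight nu c *\<^sub>R (1 - x * of_real (1 - c\<^sup>2)) powr (- 1 / 2)) integrable_on cbox (-1) 1"
        using * nu unfolding interval_cbox[symmetric]
        by (intro integrable_continuous_real continuous_on_powr_const_complex continuous_intros) (auto simp del: of_real_diff)
    next
      have "continuous_on (ball z e \<times> cbox (-1) 1) (\<lambda>p. legendre_weight nu (snd p) *\<^sub>R ((1 - fst p * of_real (1 - (snd p)\<^sup>2)) powr (-3/2) * (of_real (1 - (snd p)\<^sup>2) / 2)))"
        by (intro continuous_on_powr_const_complex continuous_intros nu) (use * in \<open>auto simp del: of_real_diff\<close>)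
      thus "continuous_on (ball z e \<times> cbox (-1) 1) (\<lambda>(x, c). legendre_weight nu c *\<^sub>R ((1 - x * of_real (1 - c\<^sup>2)) powr (-3/2) * (of_real (1 - c\<^sup>2) / 2)))"
        by (simp add: case_prod_unfold)
    qed auto
    thus "\<exists>e>0. legendre_I nu holomorphic_on ball z e" using e by blast
  qed
  thus ?thesis by (rule analytic_imp_holomorphic)
qed

text \<open>For \<open>\<rho> = a + \<i> * b\<close> the imaginary part is
  \<open>2 * b * (s + a)\<close>. If \<open>b = 0\<close>, the value
  \<open>(a + s)\<^sup>2 + (1 - s\<^sup>2)\<close> is nonpositive only when
  \<open>a\<^sup>2 = 1\<close>; if \<open>s = - a\<close>, the value is
  \<open>1 - a\<^sup>2 - b\<^sup>2\<close>, which is positive.\<close>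

lemma landen_not_nonpos:
  fixes \<rho> :: complex
  assumes "cmod \<rho> < 1" "s \<in> {-1..1}"
  shows "1 + 2 * \<rho> * of_real s + \<rho>\<^sup>2 \<notin> \<real>\<^sub>\<le>\<^sub>0"
proof
  assume "1 + 2 * \<rho> * of_real s + \<rho>\<^sup>2 \<in> \<real>\<^sub>\<le>\<^sub>0"
  then obtain r where r: "r \<le> 0" "1 + 2 * \<rho> * of_real s + \<rho>\<^sup>2 = of_real r" by (auto elim: nonpos_Reals_cases)
  define a b where "a = Re \<rho>" and "b = Im \<rho>"
  have re: "1 + 2 * a * s + (a\<^sup>2 - b\<^sup>2) = r" and im: "2 * b * s + 2 * a * b = 0"
    using arg_cong[OF r(2), of Re] arg_cong[OF r(2), of Im] by (simp_all add: a_def b_def Re_power2 Im_power2)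
  have ab: "a\<^sup>2 + b\<^sup>2 < 1" using assms(1) by (simp add: a_def b_def cmod_def)
  have s: "s\<^sup>2 \<le> 1" using assms(2) by (auto simp: abs_square_le_1 abs_le_iff)
  show False
  proof (cases "b = 0")
    case True
    have "(a + s)\<^sup>2 + (1 - s\<^sup>2) \<le> 0" using re True r(1) by (simp add: power2_eq_square algebra_simps)
    hence "a + s = 0" "s\<^sup>2 = 1" using s by (smt (verit) zero_le_power2 power2_eq_square mult_eq_0_iff)+
    hence "a\<^sup>2 = 1" by (metis add_eq_0_iff power2_minus)
    thus False using ab True by simp
  next
    case False
    have "2 * b * (s + a) = 0" using im by (simp add: algebra_simps)
    hence "s = -a" using False by simp
    thus False using re ab r(1) by (simp add: power2_eq_square)
  qed
qed

lemma landen_holomorphic: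
  assumes nu: "0 \<le> nu"
  shows "(\<lambda>\<rho>. integral {-1..1} (\<lambda>s. legendre_weight nu s *\<^sub>R (1 + 2 * \<rho> * of_real s + \<rho>\<^sup>2) powr (- of_real (nu + 1)))) holomorphic_on ball 0 1"
  unfolding interval_cbox
proof (rule leibniz_rule_holomorphic)
  fix x s assume xs: "x \<in> ball (0::complex) 1" "s \<in> cbox (-1) (1::real)"
  show "((\<lambda>x. legendre_weight nu s *\<^sub>R (1 + 2 * x * of_real s + x\<^sup>2) powr (- of_real (nu + 1))) has_field_derivative
     legendre_weight nu s *\<^sub>R (- of_real (nu + 1) * (1 + 2 * x * of_real s + x\<^sup>2) powr (- of_real (nu + 1) - 1) * (2 * of_real s + 2 * x))) (at x within ball 0 1)"
    unfolding scaleR_conv_of_real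
    by (rule has_field_derivative_at_within, rule DERIV_cmult)
       (use landen_not_nonpos[of x s] xs in \<open>auto intro!: derivative_eq_intros\<close>)
next
  fix x assume "x \<in> ball (0::complex) 1"
  thus "(\<lambda>s. legendre_weight nu s *\<^sub>R (1 + 2 * x * of_real s + x\<^sup>2) powr (- of_real (nu + 1))) integrable_on cbox (-1) 1"
    using landen_not_nonpos nu unfolding interval_cbox[symmetric]
    by (intro integrable_continuous_real continuous_on_powr_const_complex continuous_intros) auto
next
  have "continuous_on (ball (0::complex) 1 \<times> cbox (-1) 1) (\<lambda>p. legendre_weight nu (snd p) *\<^sub>R (- of_real (nu + 1) * (1 + 2 * fst p * of_real (snd p) + (fst p)\<^sup>2) powr (- of_real (nu + 1) - 1) * (2 * of_real (snd p) + 2 * fst p)))"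
    by (intro continuous_on_powr_const_complex continuous_intros nu) (use landen_not_nonpos in auto)
  thus "continuous_on (ball (0::complex) 1 \<times> cbox (-1) 1) (\<lambda>(x, s). legendre_weight nu s *\<^sub>R (- of_real (nu + 1) * (1 + 2 * x * of_real s + x\<^sup>2) powr (- of_real (nu + 1) - 1) * (2 * of_real s + 2 * x)))"
    by (simp add: case_prod_unfold)
qed auto

text \<open>Landen's substitution: \<open>c = (\<rho> + s) / sqrt (1 + 2 \<rho> s + \<rho>\<^sup>2)\<close> is the cosine of an angle in the
  triangle with sides \<open>1\<close> and \<open>\<rho>\<close> whose exterior angle has cosine \<open>s\<close>.\<close>

lemma landen_real:
  fixes \<rho> :: real
  assumes nu: "0 \<le> nu" and rho: "0 < \<rho>" "\<rho> < 1"
  shows "integral {-1..1} (\<lambda>s. legendre_weight nu s * (1 + 2 * \<rho> * s + \<rho>\<^sup>2) powr (- (nu + 1))) =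
         integral {-1..1} (\<lambda>c. legendre_weight nu c * (1 - \<rho>\<^sup>2 * (1 - c\<^sup>2)) powr (-1/2))"
proof -
  define R where "R s = sqrt (1 + 2 * \<rho> * s + \<rho>\<^sup>2)" for s
  define g where "g s = (\<rho> + s) / R s" for s
  define f where "f c = legendre_weight nu c * (1 - \<rho>\<^sup>2 * (1 - c\<^sup>2)) powr (-1/2)" for c
  have rs: "1 + \<rho> * s > 0" if "s \<in> {-1<..<1}" for s
  proof -
    have "\<bar>\<rho> * s\<bar> < 1 * 1" unfolding abs_mult using that rho by (intro mult_strict_mono') (auto simp: abs_less_iff)
    thus ?thesis by (simp add: abs_less_iff)
  qed
  have R0: "1 + 2 * \<rho> * s + \<rho>\<^sup>2 > 0" if "s \<in> {-1..1}" for s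
  proof -
    have "\<rho> * (-1) \<le> \<rho> * s" using that rho by (intro mult_left_mono) auto
    moreover have "(1 - \<rho>)\<^sup>2 > 0" using rho by simp
    ultimately show ?thesis by (simp add: power2_eq_square algebra_simps)
  qed
  have R2: "(R s)\<^sup>2 = 1 + 2 * \<rho> * s + \<rho>\<^sup>2" and Rpos: "R s > 0" if "s \<in> {-1..1}" for s
    using R0[OF that] by (simp_all add: R_def)
  have dR: "(R has_field_derivative \<rho> / R s) (at s)" if "s \<in> {-1<..<1}" for s
    unfolding R_def[abs_def]
    by (rule DERIV_real_sqrt[THEN DERIV_chain2, THEN DERIV_cong])
       (use R2[of s] Rpos[of s] that in \<open>auto intro!: derivative_eq_intros simp: R_def field_simps\<close>)
  have dg: "(g has_field_derivative (1 + \<rho> * s) / R s ^ 3) (at s)" if "s \<in> {-1<..<1}" for s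
    unfolding g_def[abs_def]
    by (rule DERIV_divide[OF _ dR[OF that], THEN DERIV_cong, OF DERIV_add[OF DERIV_const DERIV_ident]])
       (use R2[of s] Rpos[of s] that in \<open>auto simp: field_simps power2_eq_square power3_eq_cube\<close>)
  have g1: "1 - (g s)\<^sup>2 = (1 - s\<^sup>2) / (R s)\<^sup>2" if "s \<in> {-1<..<1}" for s
  proof -
    have "1 - (g s)\<^sup>2 = ((R s)\<^sup>2 - (\<rho> + s)\<^sup>2) / (R s)\<^sup>2"
      using Rpos[of s] that by (simp add: g_def power_divide diff_divide_distrib)
    also have "(R s)\<^sup>2 - (\<rho> + s)\<^sup>2 = 1 - s\<^sup>2"
      using R2[of s] that by (simp add: power2_eq_square algebra_simps)
    finally show ?thesis .
  qed
  \<comment> \<open>The elliptic factor becomes a perfect square, whose root cancels the numerator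
    \<open>1 + \<rho> * s\<close> of the derivative of \<open>g\<close>.\<close>
  have g2: "1 - \<rho>\<^sup>2 * (1 - (g s)\<^sup>2) = ((1 + \<rho> * s) / R s)\<^sup>2" if "s \<in> {-1<..<1}" for s
  proof -
    have "1 - \<rho>\<^sup>2 * (1 - (g s)\<^sup>2) = ((R s)\<^sup>2 - \<rho>\<^sup>2 * (1 - s\<^sup>2)) / (R s)\<^sup>2"
      unfolding g1[OF that] by (subst diff_divide_distrib) (use Rpos[of s] that in simp)
    also have "(R s)\<^sup>2 - \<rho>\<^sup>2 * (1 - s\<^sup>2) = (1 + \<rho> * s)\<^sup>2"
      using R2[of s] that by (simp add: power2_eq_square algebra_simps)
    finally show ?thesis by (simp add: power_divide)
  qed
  have mono: "strict_mono_on {-1<..<1} g"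
  proof (rule strict_mono_onI)
    fix a b :: real assume ab: "a \<in> {-1<..<1}" "b \<in> {-1<..<1}" "a < b"
    show "g a < g b"
    proof (rule DERIV_pos_imp_increasing[OF ab(3)])
      fix x assume "a \<le> x" "x \<le> b"
      hence x: "x \<in> {-1<..<1}" using ab by auto
      show "\<exists>y. DERIV g x :> y \<and> 0 < y"
        by (rule exI[of _ "(1 + \<rho> * x) / R x ^ 3"]) (use dg[OF x] rs[OF x] Rpos[of x] x in auto)
    qed
  qed
  have im: "g ` {-1<..<1} = {-1<..<1}"
  proof (intro equalityI subsetI)
    fix c assume "c \<in> g ` {-1<..<1}"
    then obtain s where s: "s \<in> {-1<..<1}" "c = g s" by blast
    have "s\<^sup>2 < 1" using s by (auto simp: abs_square_less_1 abs_less_iff)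
    hence "1 - c\<^sup>2 > 0" unfolding s(2) g1[OF s(1)] using Rpos[of s] s by simp
    thus "c \<in> {-1<..<1}" by (auto simp: abs_square_less_1 abs_less_iff)
  next
    fix c :: real assume c: "c \<in> {-1<..<1}"
    have R1: "R (-1) = 1 - \<rho>" "R 1 = 1 + \<rho>"
      unfolding R_def by (rule real_sqrt_unique; use rho in \<open>simp add: power2_eq_square algebra_simps\<close>)+
    have ends: "g (-1) = -1" "g 1 = 1"
      using rho by (simp_all add: g_def R1 divide_eq_eq)
    have "continuous_on {-1..1} g"
      unfolding g_def R_def using R0 by (intro continuous_intros) force
    then obtain s where s: "-1 \<le> s" "s \<le> 1" "g s = c"
      using IVT'[of g "-1" c 1] c ends by auto
    moreover have "s \<noteq> -1" "s \<noteq> 1" using s ends c by auto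
    ultimately show "c \<in> g ` {-1<..<1}" by (intro image_eqI[of _ _ s]) auto
  qed
  \<comment> \<open>The exponents of \<open>R s\<close> add up: \<open>-3\<close> from the
    derivative, \<open>1\<close> from the elliptic factor and \<open>-2 * nu\<close> from the weight
    make \<open>-2 * (nu + 1)\<close>.\<close>
  have eq: "\<bar>(1 + \<rho> * s) / R s ^ 3\<bar> * f (g s) = legendre_weight nu s * (1 + 2 * \<rho> * s + \<rho>\<^sup>2) powr (- (nu + 1))"
    if s: "s \<in> {-1<..<1}" for s
  proof -
    have Rs: "R s > 0" using Rpos[of s] s by simp
    have gs: "\<bar>g s\<bar> < 1" using im s by (auto simp: abs_less_iff)
    have s2: "s\<^sup>2 < 1" using s by (auto simp: abs_square_less_1 abs_less_iff)
    have e1: "legendre_weight nu (g s) = (1 - s\<^sup>2) powr nu / (R s)\<^sup>2 powr nu"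
      unfolding legendre_weight_eq_powr[OF gs] g1[OF s] using s2 by (simp add: powr_divide)
    have e2: "((1 + \<rho> * s) / R s)\<^sup>2 powr (-1/2) = R s / (1 + \<rho> * s)"
    proof -
      have "((1 + \<rho> * s) / R s)\<^sup>2 powr (-1/2) = inverse (sqrt (((1 + \<rho> * s) / R s)\<^sup>2))"
        using powr_minus[of "((1 + \<rho> * s) / R s)\<^sup>2" "1/2"] by (simp add: powr_half_sqrt)
      thus ?thesis using Rs rs[OF s] by (simp add: real_sqrt_divide)
    qed
    have e3: "(1 + 2 * \<rho> * s + \<rho>\<^sup>2) powr (- (nu + 1)) = 1 / ((R s)\<^sup>2 powr nu * (R s)\<^sup>2)"
    proof -
      have "(R s)\<^sup>2 powr (- (nu + 1)) = 1 / ((R s)\<^sup>2 powr nu * (R s)\<^sup>2)"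
        using Rs by (subst powr_minus) (simp add: powr_add divide_inverse)
      thus ?thesis using R2[of s] s by simp
    qed
    have e4: "legendre_weight nu s = (1 - s\<^sup>2) powr nu"
      using s by (intro legendre_weight_eq_powr) (auto simp: abs_less_iff)
    have "\<bar>(1 + \<rho> * s) / R s ^ 3\<bar> = (1 + \<rho> * s) / R s ^ 3" using Rs rs[OF s] by simp
    thus ?thesis
      unfolding f_def g2[OF s] e1 e2 e3 e4 using Rs rs[OF s] by (simp add: power2_eq_square power3_eq_cube)
  qed
  have pos: "1 - \<rho>\<^sup>2 * (1 - c\<^sup>2) > 0" if "c \<in> {-1..1}" for c
  proof -
    have "\<rho>\<^sup>2 < 1" using rho by (simp add: abs_square_less_1)
    moreover have "\<rho>\<^sup>2 * (1 - c\<^sup>2) \<le> \<rho>\<^sup>2 * 1" by (intro mult_left_mono) auto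
    ultimately show ?thesis by simp
  qed
  have "f absolutely_integrable_on {-1..1}"
    unfolding f_def using pos by (intro absolutely_integrable_continuous_real continuous_intros nu) force+
  hence f1: "f absolutely_integrable_on {-1<..<1}"
    by (rule set_integrable_subset) auto
  hence "f absolutely_integrable_on g ` {-1<..<1} \<and> integral (g ` {-1<..<1}) f = integral {-1<..<1} f"
    unfolding im by simp
  hence "integral {-1<..<1} (\<lambda>s. \<bar>(1 + \<rho> * s) / R s ^ 3\<bar> * f (g s)) = integral {-1<..<1} f"
    by (subst (asm) has_absolute_integral_change_of_variables_1'[symmetric])
       (use dg strict_mono_on_imp_inj_on[OF mono] in \<open>auto intro: has_field_derivative_at_within\<close>)
  also have "integral {-1<..<1} (\<lambda>s. \<bar>(1 + \<rho> * s) / R s ^ 3\<bar> * f (g s)) =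
      integral {-1<..<1} (\<lambda>s. legendre_weight nu s * (1 + 2 * \<rho> * s + \<rho>\<^sup>2) powr (- (nu + 1)))"
    by (rule Henstock_Kurzweil_Integration.integral_cong) (rule eq)
  finally show ?thesis by (simp add: integral_open_interval_real f_def)
qed

text \<open>Without integrability both integrals are \<open>0\<close> by convention, since taking
  real parts shows that integrability of one function forces that of the other.\<close>

lemma integral_complex_of_real_HK:
  fixes f :: "'n::euclidean_space \<Rightarrow> real"
  shows "integral A (\<lambda>x. complex_of_real (f x)) = of_real (integral A f)"
proof (cases "f integrable_on A")
  case True
  thus ?thesis by (intro integral_unique has_integral_of_real integrable_integral)
next
  case False
  have "\<not> (\<lambda>x. complex_of_real (f x)) integrable_on A"
    using integrable_linear[OF _ bounded_linear_Re, of "\<lambda>x. complex_of_real (f x)" A] False by (auto simp: o_def)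
  thus ?thesis using False by (simp add: not_integrable_integral)
qed

lemma square_le_1_of_mem: "c \<in> {-1..1} \<Longrightarrow> (c::real)\<^sup>2 \<le> 1"
  by (auto simp: abs_square_le_1 abs_le_iff)

lemma legendre_I_of_real:
  assumes "k \<le> 1"
  shows "legendre_I nu (of_real k) = of_real (integral {-1..1} (\<lambda>c. legendre_weight nu c * (1 - k * (1 - c\<^sup>2)) powr (-1/2)))"
  unfolding legendre_I_def integral_complex_of_real_HK[symmetric]
proof (rule Henstock_Kurzweil_Integration.integral_cong)
  fix c :: real assume c: "c \<in> {-1..1}"
  have "k * (1 - c\<^sup>2) \<le> 1 * (1 - c\<^sup>2)"
    using assms square_le_1_of_mem[OF c] by (intro mult_right_mono) auto
  also have "\<dots> \<le> 1" by simp
  finally have "0 \<le> 1 - k * (1 - c\<^sup>2)" by simp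
  from powr_of_real[OF this, of "-1/2"]
  show "legendre_weight nu c *\<^sub>R (1 - of_real k * of_real (1 - c\<^sup>2)) powr (-1/2) =
        complex_of_real (legendre_weight nu c * (1 - k * (1 - c\<^sup>2)) powr (-1/2))"
    by (simp add: scaleR_conv_of_real)
qed

text \<open>Both sides are holomorphic in the unit disc, where \<open>\<rho>\<^sup>2\<close> avoids
  the slit, and they agree on the segment \<open>(0, 1)\<close>, which accumulates at
  \<open>0\<close>. The identity theorem applies.\<close>

lemma landen_complex:
  assumes nu: "0 \<le> nu" and rho: "cmod \<rho> < 1"
  shows "integral {-1..1} (\<lambda>s. legendre_weight nu s *\<^sub>R (1 + 2 * \<rho> * of_real s + \<rho>\<^sup>2) powr (- of_real (nu + 1))) =
    legendre_I nu (\<rho>\<^sup>2)" (is "?L \<rho> = _")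
proof -
  have "?L \<rho> - legendre_I nu (\<rho>\<^sup>2) = 0"
  proof (rule analytic_continuation[of "\<lambda>\<rho>. ?L \<rho> - legendre_I nu (\<rho>\<^sup>2)" "ball 0 1" "of_real ` {0<..<1}" 0])
    have "(legendre_I nu \<circ> (\<lambda>\<rho>. \<rho>\<^sup>2)) holomorphic_on ball 0 1"
    proof (rule holomorphic_on_compose_gen[OF _ legendre_I_holomorphic[OF nu]])
      show "(\<lambda>\<rho>. \<rho>\<^sup>2) ` ball 0 1 \<subseteq> - complex_of_real ` {1..}"
      proof
        fix y :: complex assume "y \<in> (\<lambda>\<rho>. \<rho>\<^sup>2) ` ball 0 1"
        hence "cmod y < 1" by (auto simp: norm_power power_less_one_iff abs_square_less_1)
        thus "y \<in> - of_real ` {1..}" by auto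
      qed
    qed (intro holomorphic_intros)
    thus "(\<lambda>\<rho>. ?L \<rho> - legendre_I nu (\<rho>\<^sup>2)) holomorphic_on ball 0 1"
      by (intro holomorphic_on_diff landen_holomorphic nu) (simp add: o_def)
    show "0 islimpt complex_of_real ` {0<..<1}"
      unfolding islimpt_approachable
    proof (intro allI impI)
      fix e :: real assume "0 < e"
      thus "\<exists>x'\<in>complex_of_real ` {0<..<1}. x' \<noteq> 0 \<and> dist x' 0 < e"
        by (intro bexI[of _ "of_real (min (e/2) (1/2))"] conjI imageI) (auto simp: norm_of_real min_def)
    qed
    show "?L z - legendre_I nu (z\<^sup>2) = 0" if zU: "z \<in> complex_of_real ` {0<..<1}" for z
    proof -
      obtain r where "z = of_real r" "r \<in> {0<..<1}" using zU by blast
      hence r: "0 < r" "r < 1" "z = of_real r" by auto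
      have "?L z = integral {-1..1} (\<lambda>s. complex_of_real (legendre_weight nu s * (1 + 2 * r * s + r\<^sup>2) powr (- (nu + 1))))"
      proof (rule Henstock_Kurzweil_Integration.integral_cong)
        fix s :: real assume s: "s \<in> {-1..1}"
        have "1 + 2 * r * s + r\<^sup>2 = (r + s)\<^sup>2 + (1 - s\<^sup>2)" by (simp add: power2_eq_square algebra_simps)
        moreover have "0 \<le> (r + s)\<^sup>2 + (1 - s\<^sup>2)"
          using square_le_1_of_mem[OF s] by (intro add_nonneg_nonneg) auto
        ultimately have "0 \<le> 1 + 2 * r * s + r\<^sup>2" by (simp only:)
        from powr_of_real[OF this, of "- (nu + 1)"]
        show "legendre_weight nu s *\<^sub>R (1 + 2 * z * of_real s + z\<^sup>2) powr (- of_real (nu + 1)) =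
           complex_of_real (legendre_weight nu s * (1 + 2 * r * s + r\<^sup>2) powr (- (nu + 1)))"
          by (simp add: scaleR_conv_of_real r)
      qed
      also have "\<dots> = legendre_I nu (of_real (r\<^sup>2))"
        unfolding integral_complex_of_real_HK landen_real[OF nu r(1,2)]
        by (rule legendre_I_of_real[symmetric]) (use r in \<open>simp add: power_le_one\<close>)
      finally show ?thesis by (simp add: r)
    qed
  qed (use rho in auto)
  thus ?thesis by simp
qed

text \<open>These are the two roots of \<open>\<rho>\<^sup>2 - 2 * z * \<rho> + 1\<close>, that is,
  the preimages of \<open>z\<close> under the Joukowski map
  \<open>(\<rho> + 1 / \<rho>) / 2\<close>.\<close>

lemma csqrt_conjugates:
  fixes z :: complex
  defines "w \<equiv> csqrt (1 - z\<^sup>2)"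
  shows "(z - \<i> * w) * (z + \<i> * w) = 1" "(z - \<i> * w) + (z + \<i> * w) = 2 * z"
proof -
  have "w\<^sup>2 = 1 - z\<^sup>2" by (simp add: w_def)
  thus "(z - \<i> * w) * (z + \<i> * w) = 1" by (simp add: power2_eq_square algebra_simps)
qed simp

text \<open>As \<open>2 * z = \<rho> + 1 / \<rho>\<close>, multiplying \<open>2 * (z + s)\<close> by
  \<open>\<rho>\<close> gives Landen's quadratic. The principal root has nonnegative real part, so
  the other root \<open>v = 1 / \<rho>\<close> has positive imaginary part; comparing imaginary
  parts in \<open>\<rho> + v = 2 * z\<close> then forces \<open>cmod v > 1\<close>.\<close>

lemma legendre_Q_upper_eq_legendre_I:
  fixes z :: complex
  assumes nu: "0 \<le> nu" and z: "0 < Im z"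
  defines "\<rho> \<equiv> z - \<i> * csqrt (1 - z\<^sup>2)"
  shows "legendre_Q_upper nu z = \<rho> powr of_real (nu + 1) * legendre_I nu (\<rho>\<^sup>2)"
proof -
  define v where "v = z + \<i> * csqrt (1 - z\<^sup>2)"
  have rv: "\<rho> * v = 1" "\<rho> + v = 2 * z"
    unfolding \<rho>_def v_def by (rule csqrt_conjugates)+
  have v0: "v \<noteq> 0" and r0: "\<rho> \<noteq> 0" using rv(1) by auto
  define w where "w = csqrt (1 - z\<^sup>2)"
  have "0 \<le> Re w" using csqrt_principal[of "1 - z\<^sup>2"] by (auto simp: w_def simp del: csqrt.simps)
  hence Imv: "Im v > 0" using z by (simp add: v_def flip: w_def)
  have rinv: "\<rho> = inverse v" using rv(1) v0 by (simp add: field_simps)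
  have Imr: "Im \<rho> = - Im v / (cmod v)\<^sup>2" by (simp add: rinv cmod_power2)
  have "Im v - Im v / (cmod v)\<^sup>2 > 0"
    using arg_cong[OF rv(2), of Im] z Imr by simp
  hence "Im v * ((cmod v)\<^sup>2 - 1) > 0" using v0 by (simp add: field_simps)
  hence "1 < (cmod v)\<^sup>2" using Imv by (simp add: zero_less_mult_iff)
  hence "1 < cmod v" using power2_less_imp_less[of 1 "cmod v"] by simp
  hence r1: "cmod \<rho> < 1" by (simp add: rinv norm_inverse inverse_less_1_iff)
  have Imr': "Im \<rho> < 0" using Imr Imv v0 by (simp add: divide_neg_pos)
  have eq: "legendre_weight nu s *\<^sub>R (2 * (z + of_real s)) powr (- of_real (nu + 1)) =
     \<rho> powr of_real (nu + 1) * (legendre_weight nu s *\<^sub>R (1 + 2 * \<rho> * of_real s + \<rho>\<^sup>2) powr (- of_real (nu + 1)))" for s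
  proof -
    define y where "y = 2 * (z + of_real s)"
    have y: "Im y > 0" using z by (simp add: y_def)
    hence y0: "y \<noteq> 0" by auto
    have "\<rho> * y = \<rho> * (\<rho> + v) + 2 * \<rho> * of_real s" unfolding rv(2) by (simp add: y_def algebra_simps)
    also have "\<dots> = 1 + 2 * \<rho> * of_real s + \<rho>\<^sup>2" using rv(1) by (simp add: algebra_simps power2_eq_square)
    finally have X: "1 + 2 * \<rho> * of_real s + \<rho>\<^sup>2 = \<rho> * y" ..
    \<comment> \<open>The argument of \<open>\<rho>\<close> lies in \<open>(- pi, 0)\<close> and
      that of \<open>y\<close> in \<open>(0, pi)\<close>, so their sum is still principal.\<close>
    have "Ln (\<rho> * y) = Ln \<rho> + Ln y"
    proof (rule Ln_times_simple)
      have "0 < Im (Ln v) \<and> Im (Ln v) < pi" by (rule Im_Ln_pos_lt_imp[OF Imv])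
      moreover have "Ln \<rho> = - Ln v"
        unfolding rinv using Imv by (intro Ln_inverse) (auto simp: complex_nonpos_Reals_iff)
      ultimately show "- pi < Im (Ln \<rho>) + Im (Ln y)" "Im (Ln \<rho>) + Im (Ln y) \<le> pi"
        using Im_Ln_pos_lt_imp[OF y] by auto
    qed (use r0 y0 in auto)
    hence "(\<rho> * y) powr (- of_real (nu + 1)) = \<rho> powr (- of_real (nu + 1)) * y powr (- of_real (nu + 1))"
      using r0 y0 by (simp add: powr_def algebra_simps flip: exp_add)
    hence "\<rho> powr of_real (nu + 1) * (\<rho> * y) powr (- of_real (nu + 1)) = y powr (- of_real (nu + 1))"
      using r0 by (simp add: mult.assoc[symmetric] powr_add[symmetric] del: of_real_add)
    thus ?thesis unfolding X y_def[symmetric] by (simp add: scaleR_conv_of_real mult.left_commute)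
  qed
  have "legendre_Q_upper nu z = \<rho> powr of_real (nu + 1) *
     integral {-1..1} (\<lambda>s. legendre_weight nu s *\<^sub>R (1 + 2 * \<rho> * of_real s + \<rho>\<^sup>2) powr (- of_real (nu + 1)))"
    by (simp only: legendre_Q_upper_eq[OF nu z] eq Henstock_Kurzweil_Integration.integral_mult_right)
  thus ?thesis unfolding landen_complex[OF nu r1] .
qed

subsection \<open>Boundary values\<close>

text \<open>Boundary values are defined by \<open>Lim\<close>, so a formula in the half-plane that
  extends continuously to \<open>x\<close> determines them; \<open>x\<close> being a limit point of
  the half-plane makes the limit unique.\<close>

lemma legendre_Q_of_real:
  assumes "\<And>z. 0 < Im z \<Longrightarrow> legendre_Q_upper nu z = h z" and "isCont h (of_real x)"
  shows "legendre_Q nu (of_real x) = h (of_real x)"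
proof -
  let ?F = "at (complex_of_real x) within {w. Im w > 0}"
  have "(h \<longlongrightarrow> h (of_real x)) ?F"
    using assms(2) by (auto simp: isCont_def intro: tendsto_within_subset)
  hence "(legendre_Q_upper nu \<longlongrightarrow> h (of_real x)) ?F"
    by (rule Lim_transform_eventually) (use assms(1) in \<open>auto simp: eventually_at_filter\<close>)
  moreover have "complex_of_real x islimpt {w. Im w > 0}"
    unfolding islimpt_approachable
  proof (intro allI impI)
    fix e :: real assume "0 < e"
    thus "\<exists>x'\<in>{w. Im w > 0}. x' \<noteq> of_real x \<and> dist x' (of_real x) < e"
      by (intro bexI[of _ "Complex x (e/2)"]) (auto simp: dist_norm complex_eq_iff cmod_def)
  qed
  hence "\<not> trivial_limit ?F" by (simp add: trivial_limit_within)
  ultimately have "Lim ?F (legendre_Q_upper nu) = h (of_real x)" by (intro tendsto_Lim)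
  thus ?thesis by (simp add: legendre_Q_def)
qed

text \<open>For \<open>Re z > 1\<close> the base \<open>2 * (z + s)\<close> has positive real part,
  so the half-plane integral continues across the real axis and is real there.\<close>

lemma legendre_Q_gt_1:
  assumes nu: "0 \<le> nu" and x: "1 < x"
  shows "legendre_Q nu (of_real x) = of_real (integral {-1..1} (\<lambda>s. legendre_weight nu s * (2 * (x + s)) powr (- (nu + 1))))"
proof -
  let ?h = "\<lambda>z::complex. integral {-1..1} (\<lambda>s. legendre_weight nu s *\<^sub>R (2 * (z + of_real s)) powr (- of_real (nu + 1)))"
  have c: "continuous_on {z. 1 < Re z} ?h"
    unfolding interval_cbox
  proof (rule integral_continuous_on_param)
    have "continuous_on ({z. 1 < Re z} \<times> cbox (-1) 1) (\<lambda>p. legendre_weight nu (snd p) *\<^sub>R (2 * (fst p + of_real (snd p))) powr (- of_real (nu + 1)))"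
      by (intro continuous_on_powr_const_complex continuous_intros nu) (auto simp: complex_nonpos_Reals_iff)
    thus "continuous_on ({z. 1 < Re z} \<times> cbox (-1) 1) (\<lambda>(z, s). legendre_weight nu s *\<^sub>R (2 * (z + of_real s)) powr (- of_real (nu + 1)))"
      by (simp add: case_prod_unfold)
  qed
  have "isCont ?h (of_real x)"
    by (rule continuous_on_interior[OF c]) (use x in \<open>simp add: interior_open open_halfspace_Re_gt\<close>)
  hence "legendre_Q nu (of_real x) = ?h (of_real x)"
    by (intro legendre_Q_of_real[of nu ?h] legendre_Q_upper_eq[OF nu])
  also have "\<dots> = integral {-1..1} (\<lambda>s. complex_of_real (legendre_weight nu s * (2 * (x + s)) powr (- (nu + 1))))"
  proof (rule Henstock_Kurzweil_Integration.integral_cong)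
    fix s :: real assume "s \<in> {-1..1}"
    hence "0 \<le> 2 * (x + s)" using x by simp
    from powr_of_real[OF this, of "- (nu + 1)"]
    show "legendre_weight nu s *\<^sub>R (2 * (of_real x + of_real s)) powr (- of_real (nu + 1)) = complex_of_real (legendre_weight nu s * (2 * (x + s)) powr (- (nu + 1)))"
      by (simp add: scaleR_conv_of_real)
  qed
  finally show ?thesis unfolding integral_complex_of_real_HK .
qed

section \<open>Continuation of the squared modulus from \<open>(0, 1)\<close> to the unit
  disc\<close>

lemma cnj_legendre_I:
  assumes "\<kappa> \<notin> of_real ` {1..}"
  shows "cnj (legendre_I nu \<kappa>) = legendre_I nu (cnj \<kappa>)"
  unfolding legendre_I_def integral_cnj
proof (rule Henstock_Kurzweil_Integration.integral_cong)
  fix c :: real assume c: "c \<in> {-1..1}"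
  have "1 - \<kappa> * of_real (1 - c\<^sup>2) \<notin> \<real>\<^sub>\<le>\<^sub>0"
    by (rule legendre_I_base_not_nonpos[OF c]) (use assms in auto)
  hence "cnj ((1 - \<kappa> * of_real (1 - c\<^sup>2)) powr (-1/2)) = cnj (1 - \<kappa> * of_real (1 - c\<^sup>2)) powr cnj (-1/2)"
    by (intro cnj_powr) (auto simp: complex_nonpos_Reals_iff)
  thus "cnj (legendre_weight nu c *\<^sub>R (1 - \<kappa> * of_real (1 - c\<^sup>2)) powr (-1/2)) =
     legendre_weight nu c *\<^sub>R (1 - cnj \<kappa> * of_real (1 - c\<^sup>2)) powr (-1/2)"
    by (simp add: scaleR_conv_of_real)
qed

text \<open>A holomorphic stand-in for the squared modulus: for real \<open>x\<close> in
  \<open>(0, 1)\<close> the two arguments are complex conjugates. The product is symmetric in the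
  two square roots of \<open>1 - x\<^sup>2\<close>.\<close>

definition legendre_G :: "real \<Rightarrow> complex \<Rightarrow> complex" where
  "legendre_G nu x = legendre_I nu ((x - \<i> * csqrt (1 - x\<^sup>2))\<^sup>2) * legendre_I nu ((x + \<i> * csqrt (1 - x\<^sup>2))\<^sup>2)"

text \<open>If the square of one root is a real \<open>r \<ge> 1\<close>, that of the other is
  \<open>1 / r\<close>, and squaring their sum gives
  \<open>4 * x\<^sup>2 = r + 1 / r + 2 \<ge> 4\<close>, contrary to
  \<open>cmod x < 1\<close>.\<close>

lemma csqrt_conjugates_square:
  fixes x :: complex
  assumes "cmod x < 1"
  shows "(x - \<i> * csqrt (1 - x\<^sup>2))\<^sup>2 \<notin> of_real ` {1..}" "(x + \<i> * csqrt (1 - x\<^sup>2))\<^sup>2 \<notin> of_real ` {1..}"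
proof -
  have *: False if vw: "v * w = 1" "v + w = 2 * x" and r: "v\<^sup>2 = of_real r" "1 \<le> r" for v w :: complex and r
  proof -
    have "w\<^sup>2 * v\<^sup>2 = 1" using vw(1) by (simp add: power_mult_distrib[symmetric] mult.commute)
    hence w: "w\<^sup>2 = of_real (1 / r)" unfolding r using r(2) by (simp add: field_simps)
    have "4 * x\<^sup>2 = (v + w)\<^sup>2" unfolding vw(2) by (simp add: power_mult_distrib)
    also have "\<dots> = v\<^sup>2 + w\<^sup>2 + 2 * (v * w)" by (simp add: power2_eq_square algebra_simps)
    also have "\<dots> = of_real (r + 1 / r + 2)" unfolding r w vw(1) by simp
    finally have "4 * (cmod x)\<^sup>2 = \<bar>r + 1 / r + 2\<bar>"
      by (metis norm_mult norm_numeral norm_of_real norm_power)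
    moreover have "r + 1 / r + 2 = 4 + (r - 1)\<^sup>2 / r" using r(2) by (simp add: field_simps power2_eq_square)
    moreover have "(r - 1)\<^sup>2 / r \<ge> 0" using r(2) by simp
    moreover have "(cmod x)\<^sup>2 < 1" using assms by (simp add: abs_square_less_1)
    ultimately show False by linarith
  qed
  show "(x - \<i> * csqrt (1 - x\<^sup>2))\<^sup>2 \<notin> of_real ` {1..}"
    using *[OF csqrt_conjugates[of x]] by auto
  show "(x + \<i> * csqrt (1 - x\<^sup>2))\<^sup>2 \<notin> of_real ` {1..}"
    using *[of "x + \<i> * csqrt (1 - x\<^sup>2)" "x - \<i> * csqrt (1 - x\<^sup>2)"] csqrt_conjugates[of x]
    by (auto simp: mult.commute add.commute)
qed

lemma legendre_G_holomorphic:
  assumes nu: "0 \<le> nu"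
  shows "legendre_G nu holomorphic_on ball 0 1"
proof -
  have np: "1 - x\<^sup>2 \<notin> \<real>\<^sub>\<le>\<^sub>0" if "x \<in> ball 0 1" for x :: complex
  proof
    assume "1 - x\<^sup>2 \<in> \<real>\<^sub>\<le>\<^sub>0"
    hence "1 \<le> Re (x\<^sup>2)" by (simp add: complex_nonpos_Reals_iff)
    also have "\<dots> \<le> cmod (x\<^sup>2)" by (rule complex_Re_le_cmod)
    also have "\<dots> < 1" using that by (simp add: norm_power abs_square_less_1)
    finally show False by simp
  qed
  have "(legendre_I nu \<circ> (\<lambda>x. (x - \<i> * csqrt (1 - x\<^sup>2))\<^sup>2)) holomorphic_on ball 0 1"
    by (rule holomorphic_on_compose_gen[OF _ legendre_I_holomorphic[OF nu]])
       (use np csqrt_conjugates_square in \<open>force intro!: holomorphic_intros\<close>)+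
  moreover have "(legendre_I nu \<circ> (\<lambda>x. (x + \<i> * csqrt (1 - x\<^sup>2))\<^sup>2)) holomorphic_on ball 0 1"
    by (rule holomorphic_on_compose_gen[OF _ legendre_I_holomorphic[OF nu]])
       (use np csqrt_conjugates_square in \<open>force intro!: holomorphic_intros\<close>)+
  ultimately show ?thesis
    unfolding legendre_G_def[abs_def] o_def by (rule holomorphic_on_mult)
qed

text \<open>On \<open>(0, 1)\<close> the roots are conjugate of modulus one with real part
  \<open>x > 0\<close>. The power of \<open>\<rho>\<close> is therefore continuous there and drops
  out of the modulus, and conjugating \<open>legendre_I nu (\<rho>\<^sup>2)\<close> gives the second
  factor of \<open>legendre_G\<close>.\<close>

lemma norm_legendre_Q_unit:
  assumes nu: "0 \<le> nu" and x: "0 < x" "x < 1"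
  shows "complex_of_real ((cmod (legendre_Q nu (of_real x)))\<^sup>2) = legendre_G nu (of_real x)"
proof -
  let ?r = "\<lambda>z::complex. z - \<i> * csqrt (1 - z\<^sup>2)"
  let ?h = "\<lambda>z. ?r z powr of_real (nu + 1) * legendre_I nu ((?r z)\<^sup>2)"
  define \<rho> where "\<rho> = ?r (of_real x)"
  have x2: "x\<^sup>2 < 1" using x by (simp add: abs_square_less_1)
  have cs: "csqrt (1 - (complex_of_real x)\<^sup>2) = of_real (sqrt (1 - x\<^sup>2))"
    using x2 by (subst of_real_sqrt) auto
  have rho: "\<rho> = Complex x (- sqrt (1 - x\<^sup>2))"
    unfolding \<rho>_def cs by (simp add: complex_eq_iff)
  have crho: "of_real x + \<i> * csqrt (1 - (of_real x)\<^sup>2) = cnj \<rho>"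
    unfolding rho cs by (simp add: complex_eq_iff)
  have n1: "cmod \<rho> = 1" using x2 by (simp add: rho cmod_def)
  have "cmod (of_real x) < 1" using x by simp
  note nI = csqrt_conjugates_square(1)[OF this, folded \<rho>_def]
  have cr: "isCont ?r (of_real x)"
    using x2 by (intro continuous_intros isCont_csqrt') (auto simp: complex_nonpos_Reals_iff)
  have "isCont (\<lambda>w. w powr of_real (nu + 1)) \<rho>"
    using x by (intro DERIV_isCont[OF has_field_derivative_powr]) (auto simp: rho complex_nonpos_Reals_iff)
  hence 1: "isCont (\<lambda>z. ?r z powr of_real (nu + 1)) (of_real x)"
    unfolding \<rho>_def by (rule isCont_o2[OF cr])
  have "isCont (legendre_I nu) (\<rho>\<^sup>2)"
    using holomorphic_on_imp_continuous_on[OF legendre_I_holomorphic[OF nu]] nI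
    by (simp add: continuous_on_eq_continuous_at open_slit_plane)
  hence 2: "isCont (\<lambda>z. legendre_I nu ((?r z)\<^sup>2)) (of_real x)"
    unfolding \<rho>_def by (rule isCont_o2[where g = "legendre_I nu", rotated]) (intro continuous_intros cr)
  have "isCont ?h (of_real x)" by (rule isCont_mult[OF 1 2])
  hence "legendre_Q nu (of_real x) = \<rho> powr of_real (nu + 1) * legendre_I nu (\<rho>\<^sup>2)"
    unfolding \<rho>_def by (intro legendre_Q_of_real[of nu ?h] legendre_Q_upper_eq_legendre_I[OF nu])
  moreover have "cmod (\<rho> powr of_real (nu + 1)) = 1"
    using n1 by (auto simp: powr_def)
  ultimately have "cmod (legendre_Q nu (of_real x)) = cmod (legendre_I nu (\<rho>\<^sup>2))" by (simp add: norm_mult)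
  hence "complex_of_real ((cmod (legendre_Q nu (of_real x)))\<^sup>2) = of_real ((cmod (legendre_I nu (\<rho>\<^sup>2)))\<^sup>2)"
    by simp
  also have "\<dots> = legendre_I nu (\<rho>\<^sup>2) * cnj (legendre_I nu (\<rho>\<^sup>2))"
    by (rule complex_norm_square)
  also have "cnj (legendre_I nu (\<rho>\<^sup>2)) = legendre_I nu ((cnj \<rho>)\<^sup>2)"
    using cnj_legendre_I[OF nI] by simp
  finally show ?thesis unfolding legendre_G_def crho \<rho>_def .
qed

subsection \<open>A product formula on the negative axis\<close>

text \<open>Puts a finite nonnegative integral into the form used by the change of variables theorem
  for absolutely integrable functions.\<close>

lemma nn_integral_eq_absolutely_integrable:
  fixes h :: "real \<Rightarrow> real"
  assumes [measurable]: "h \<in> borel_measurable borel" "T \<in> sets borel"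
    and nonneg: "\<And>x. x \<in> T \<Longrightarrow> 0 \<le> h x" and r: "0 \<le> r"
  shows "(\<integral>\<^sup>+x. ennreal (h x) * indicator T x \<partial>lborel) = ennreal r \<longleftrightarrow>
         h absolutely_integrable_on T \<and> integral T h = r"
proof
  assume *: "h absolutely_integrable_on T \<and> integral T h = r"
  hence "(h has_integral r) T"
    using set_lebesgue_integral_eq_integral(1)[of T h] by (auto simp: has_integral_iff)
  thus "(\<integral>\<^sup>+x. ennreal (h x) * indicator T x \<partial>lborel) = ennreal r"
    by (intro nn_integral_has_integral_lebesgue' nonneg)
next
  assume *: "(\<integral>\<^sup>+x. ennreal (h x) * indicator T x \<partial>lborel) = ennreal r"
  also have "(\<integral>\<^sup>+x. ennreal (h x) * indicator T x \<partial>lborel) = (\<integral>\<^sup>+x. ennreal (indicator T x * h x) \<partial>lborel)"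
    by (intro nn_integral_cong) (auto simp: indicator_def)
  finally have "integrable lborel (\<lambda>x. indicator T x * h x) \<and> (\<integral>x. indicator T x * h x \<partial>lborel) = r"
    by (subst (asm) nn_integral_eq_integrable) (use r nonneg in \<open>auto simp: indicator_def\<close>)
  hence si: "set_integrable lborel T h" and v: "(LINT x:T|lborel. h x) = r"
    by (auto simp: set_integrable_def set_lebesgue_integral_def)
  have "h absolutely_integrable_on T"
    using si unfolding set_integrable_def by (subst integrable_completion) auto
  thus "h absolutely_integrable_on T \<and> integral T h = r"
    using set_borel_integral_eq_integral(2)[OF si] v by simp
qed

lemma nn_integral_change_of_variables_1:
  fixes f g g' :: "real \<Rightarrow> real"
  assumes [measurable]: "f \<in> borel_measurable borel" "g \<in> borel_measurable borel" "g' \<in> borel_measurable borel"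
      "S \<in> sets borel" "g ` S \<in> sets borel"
    and der: "\<And>x. x \<in> S \<Longrightarrow> (g has_field_derivative g' x) (at x)"
    and inj: "inj_on g S" and nonneg: "\<And>x. x \<in> g ` S \<Longrightarrow> 0 \<le> f x"
  shows "(\<integral>\<^sup>+x. ennreal (f x) * indicator (g ` S) x \<partial>lborel) =
         (\<integral>\<^sup>+x. ennreal (\<bar>g' x\<bar> * f (g x)) * indicator S x \<partial>lborel)" (is "?L = ?R")
proof -
  have S: "S \<in> sets lebesgue" using assms(4) by simp
  have iff: "?L = ennreal r \<longleftrightarrow> ?R = ennreal r" if "0 \<le> r" for r
  proof -
    have "?L = ennreal r \<longleftrightarrow> f absolutely_integrable_on g ` S \<and> integral (g ` S) f = r"
      by (rule nn_integral_eq_absolutely_integrable) (use that nonneg in auto)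
    also have "\<dots> \<longleftrightarrow> (\<lambda>x. \<bar>g' x\<bar> * f (g x)) absolutely_integrable_on S \<and> integral S (\<lambda>x. \<bar>g' x\<bar> * f (g x)) = r"
      by (rule has_absolute_integral_change_of_variables_1'[symmetric])
         (use S inj der in \<open>auto intro: has_field_derivative_at_within\<close>)
    also have "\<dots> \<longleftrightarrow> ?R = ennreal r"
      by (rule nn_integral_eq_absolutely_integrable[symmetric]) (use that nonneg in auto)
    finally show ?thesis .
  qed
  \<comment> \<open>If either side is finite, its real value can serve as \<open>r\<close> in
    \<open>iff\<close>, which forces the other side to equal it.\<close>
  show ?thesis
  proof (cases "?L = \<infinity> \<and> ?R = \<infinity>")
    case False
    thus ?thesis using iff[OF enn2real_nonneg, of ?L] iff[OF enn2real_nonneg, of ?R]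
      by (cases ?L rule: ennreal_cases; cases ?R rule: ennreal_cases) auto
  qed auto
qed

section \<open>Elliptic integrals on the negative axis\<close>

lemma square_powr_minus_half:
  fixes x :: real
  assumes "0 < x"
  shows "x\<^sup>2 powr (-1/2) = 1 / x"
proof -
  have "x\<^sup>2 powr (-(1/2)) = inverse (x\<^sup>2 powr (1/2))" by (rule powr_minus)
  also have "x\<^sup>2 powr (1/2) = x" using assms by (simp add: powr_half_sqrt)
  finally show ?thesis by (simp only: minus_divide_left inverse_eq_divide)
qed

text \<open>This quadratic rational substitution is a Moebius map in \<open>\<sigma>\<^sup>2\<close>; it matches the branch points of the two
  elliptic integrals, whose cross ratios agree.\<close>

lemma elliptic_substitution:
  fixes p N :: real
  assumes p: "0 < p" and N: "0 < N" "N < 1"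
  defines "u \<equiv> (1 + p)\<^sup>2 / (4 * p)"
  shows "(\<integral>\<^sup>+w. ennreal (((1 - w) * (1 + p * w) * (w - N) * (w + N / p)) powr (-1/2)) * indicator {N<..<1} w \<partial>lborel) =
    (\<integral>\<^sup>+s. ennreal (2 * ((1 + s\<^sup>2) * ((1 - N)\<^sup>2 + 4 * u * N * (1 + s\<^sup>2))) powr (-1/2)) * indicator {0<..} s \<partial>lborel)"
proof -
  define D where "D s = 1 + p * N + (1 + p) * s\<^sup>2" for s
  define g where "g s = (1 + p * N + N * (1 + p) * s\<^sup>2) / D s" for s
  define g' where "g' s = - 2 * s * (1 + p) * (1 - N) * (1 + p * N) / (D s)\<^sup>2" for s
  define f where "f w = ((1 - w) * (1 + p * w) * (w - N) * (w + N / p)) powr (-1/2)" for w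
  define T where "T s = (1 - N)\<^sup>2 + 4 * u * N * (1 + s\<^sup>2)" for s
  have D: "0 < D s" for s unfolding D_def using p N by (intro add_pos_nonneg) auto
  \<comment> \<open>Each of the four factors under the root becomes a product over
    \<open>D s\<close>; together they contribute the square of a multiple of
    \<open>s / (D s)\<^sup>2\<close>, times \<open>(1 + s\<^sup>2) * T s\<close>.\<close>
  have g1: "1 - g s = (1 + p) * (1 - N) * s\<^sup>2 / D s" for s
  proof -
    have "1 - g s = (D s - (1 + p * N + N * (1 + p) * s\<^sup>2)) / D s"
      by (subst diff_divide_distrib) (use D[of s] in \<open>simp add: g_def\<close>)
    also have "D s - (1 + p * N + N * (1 + p) * s\<^sup>2) = (1 + p) * (1 - N) * s\<^sup>2" by (simp add: D_def algebra_simps)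
    finally show ?thesis .
  qed
  have g2: "g s - N = (1 + p * N) * (1 - N) / D s" for s
  proof -
    have "g s - N = ((1 + p * N + N * (1 + p) * s\<^sup>2) - N * D s) / D s"
      by (subst diff_divide_distrib) (use D[of s] in \<open>simp add: g_def\<close>)
    also have "(1 + p * N + N * (1 + p) * s\<^sup>2) - N * D s = (1 + p * N) * (1 - N)" by (simp add: D_def algebra_simps)
    finally show ?thesis .
  qed
  have g3: "1 + p * g s = (1 + p) * (1 + p * N) * (1 + s\<^sup>2) / D s" for s
  proof -
    have "1 + p * g s = (D s + p * (1 + p * N + N * (1 + p) * s\<^sup>2)) / D s"
      by (subst add_divide_distrib) (use D[of s] in \<open>simp add: g_def\<close>)
    also have "D s + p * (1 + p * N + N * (1 + p) * s\<^sup>2) = (1 + p) * (1 + p * N) * (1 + s\<^sup>2)"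
      by (simp add: D_def algebra_simps power2_eq_square)
    finally show ?thesis .
  qed
  have u4: "4 * u * p = (1 + p)\<^sup>2" using p by (simp add: u_def)
  have T: "0 < T s" for s
  proof -
    have "0 < u" using p by (simp add: u_def)
    thus ?thesis using N unfolding T_def by (intro add_pos_nonneg) auto
  qed
  have g4: "g s + N / p = T s / D s" for s
  proof -
    have "p * T s = p * (1 - N)\<^sup>2 + (4 * u * p) * (N * (1 + s\<^sup>2))" by (simp add: T_def algebra_simps)
    also have "\<dots> = p * (1 + p * N + N * (1 + p) * s\<^sup>2) + N * D s"
      unfolding u4 by (simp add: D_def power2_eq_square algebra_simps)
    finally have "T s / D s = (p * (1 + p * N + N * (1 + p) * s\<^sup>2) + N * D s) / (p * D s)"
      using p by (metis mult_divide_mult_cancel_left less_irrefl)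
    also have "\<dots> = g s + N / p"
      by (subst add_divide_distrib) (use D[of s] p in \<open>simp add: g_def\<close>)
    finally show ?thesis ..
  qed
  have im: "g ` {0<..} = {N<..<1}"
  proof (intro equalityI subsetI)
    fix w assume "w \<in> g ` {0<..}"
    then obtain s where s: "0 < s" "w = g s" by auto
    have "0 < 1 - g s" "0 < g s - N"
      unfolding g1 g2 using s D[of s] p N by (auto intro!: divide_pos_pos mult_pos_pos add_pos_pos)
    thus "w \<in> {N<..<1}" using s by simp
  next
    fix w assume w: "w \<in> {N<..<1}"
    define c where "c = 1 + p * N"
    \<comment> \<open>The value of \<open>(1 + p) * s\<^sup>2\<close> found by solving
      \<open>g s = w\<close>.\<close>
    define q where "q = c * (1 - w) / (w - N)"
    have c: "0 < c" using p N by (simp add: c_def add_pos_pos)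
    have q: "0 < q" using c w by (simp add: q_def)
    define s where "s = sqrt (q / (1 + p))"
    have s: "0 < s" "(1 + p) * s\<^sup>2 = q" using q p by (simp_all add: s_def)
    have "g s = (c + N * q) / (c + q)"
      unfolding g_def D_def c_def s(2)[symmetric] by (simp add: mult.assoc)
    also have "c + N * q = w * (c * (1 - N) / (w - N))" using w by (simp add: q_def field_simps)
    also have "c + q = c * (1 - N) / (w - N)" using w by (simp add: q_def field_simps)
    also have "w * (c * (1 - N) / (w - N)) / (c * (1 - N) / (w - N)) = w" using w c by simp
    finally show "w \<in> g ` {0<..}" using s by (intro image_eqI[of _ _ s]) auto
  qed
  have inj: "inj_on g {0<..}"
  proof (rule inj_onI)
    fix s t :: real assume st: "s \<in> {0<..}" "t \<in> {0<..}" "g s = g t"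
    have pos: "0 < (1 + p * N) * (1 - N)" using p N by (intro mult_pos_pos add_pos_pos) auto
    have "(1 + p * N) * (1 - N) / D s = (1 + p * N) * (1 - N) / D t"
      using st(3) by (simp flip: g2)
    hence "D s = D t" using pos D[of s] D[of t] by (auto simp: frac_eq_eq)
    hence "s\<^sup>2 = t\<^sup>2" using p by (simp add: D_def)
    thus "s = t" using st by (simp add: power2_eq_iff)
  qed
  have der: "(g has_field_derivative g' s) (at s)" for s
  proof -
    have dD: "(D has_field_derivative (1 + p) * (2 * s)) (at s)"
      unfolding D_def[abs_def] by (auto intro!: derivative_eq_intros)
    have dn: "((\<lambda>s. 1 + p * N + N * (1 + p) * s\<^sup>2) has_field_derivative N * (1 + p) * (2 * s)) (at s)"
      by (auto intro!: derivative_eq_intros)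
    have eq: "N * (1 + p) * (2 * s) * D s - (1 + p * N + N * (1 + p) * s\<^sup>2) * ((1 + p) * (2 * s)) = - 2 * s * (1 + p) * (1 - N) * (1 + p * N)"
      by (simp add: D_def algebra_simps)
    have "D s \<noteq> 0" using D[of s] by simp
    from DERIV_divide[OF dn dD this] show ?thesis
      unfolding g_def[abs_def] g'_def power2_eq_square[of "D s"] eq .
  qed
  have [measurable]: "f \<in> borel_measurable borel" "g \<in> borel_measurable borel" "g' \<in> borel_measurable borel"
    unfolding f_def[abs_def] g_def[abs_def] g'_def[abs_def] D_def[abs_def] by measurable
  have "(\<integral>\<^sup>+w. ennreal (f w) * indicator (g ` {0<..}) w \<partial>lborel) =
        (\<integral>\<^sup>+s. ennreal (\<bar>g' s\<bar> * f (g s)) * indicator {0<..} s \<partial>lborel)"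
    by (rule nn_integral_change_of_variables_1) (use inj der in \<open>auto simp: im f_def\<close>)
  also have "\<dots> = (\<integral>\<^sup>+s. ennreal (2 * ((1 + s\<^sup>2) * ((1 - N)\<^sup>2 + 4 * u * N * (1 + s\<^sup>2))) powr (-1/2)) * indicator {0<..} s \<partial>lborel)"
  proof (rule nn_integral_cong)
    fix s :: real
    show "ennreal (\<bar>g' s\<bar> * f (g s)) * indicator {0<..} s =
        ennreal (2 * ((1 + s\<^sup>2) * ((1 - N)\<^sup>2 + 4 * u * N * (1 + s\<^sup>2))) powr (-1/2)) * indicator {0<..} s"
    proof (cases "0 < s")
      case s: True
      \<comment> \<open>\<open>c / (D s)\<^sup>2\<close> is both half the Jacobian and the root of
        the square factor in the radicand, so it cancels and leaves
        \<open>2 * Y powr (-1/2)\<close>.\<close>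
      define c where "c = (1 + p) * (1 - N) * (1 + p * N) * s"
      define Y where "Y = (1 + s\<^sup>2) * T s"
      have c: "0 < c" unfolding c_def using p N s by (intro mult_pos_pos add_pos_pos) auto
      have Y: "0 < Y" unfolding Y_def using T[of s] by (intro mult_pos_pos add_pos_nonneg) auto
      have x: "0 < c / (D s)\<^sup>2" using c D[of s] by simp
      have "(1 - g s) * (1 + p * g s) * (g s - N) * (g s + N / p) = (c / (D s)\<^sup>2)\<^sup>2 * Y"
        unfolding g1 g2 g3 g4 c_def Y_def by (simp add: power2_eq_square mult_ac)
      hence "f (g s) = ((c / (D s)\<^sup>2)\<^sup>2) powr (-1/2) * Y powr (-1/2)"
        using Y by (simp add: f_def powr_mult)
      also have "\<dots> = Y powr (-1/2) / (c / (D s)\<^sup>2)"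
        unfolding square_powr_minus_half[OF x] by simp
      finally have "f (g s) = Y powr (-1/2) / (c / (D s)\<^sup>2)" .
      moreover have "\<bar>g' s\<bar> = 2 * (c / (D s)\<^sup>2)"
      proof -
        have "- 2 * s * (1 + p) * (1 - N) * (1 + p * N) = - (2 * c)" by (simp add: c_def algebra_simps)
        hence "g' s = - (2 * (c / (D s)\<^sup>2))" by (simp only: g'_def minus_divide_left times_divide_eq_right)
        thus ?thesis using c by simp
      qed
      ultimately have "\<bar>g' s\<bar> * f (g s) = 2 * Y powr (-1/2)" using c D[of s] by simp
      thus ?thesis unfolding Y_def T_def by (simp only:)
    qed simp
  qed
  finally show ?thesis unfolding im f_def .
qed

text \<open>The values of \<open>legendre_I\<close> at \<open>- p\<close>, as real numbers.\<close>

definition legendre_Ir :: "real \<Rightarrow> real \<Rightarrow> real" where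
  "legendre_Ir nu p = integral {-1..1} (\<lambda>c. legendre_weight nu c * (1 + p * (1 - c\<^sup>2)) powr (-1/2))"

lemma legendre_Ir_pos_base: "0 < p \<Longrightarrow> c \<in> {-1..1} \<Longrightarrow> 0 < 1 + p * (1 - c\<^sup>2)" for p c :: real
  using square_le_1_of_mem[of c] by (simp add: add_pos_nonneg)

lemma legendre_Ir_nonneg: "0 \<le> nu \<Longrightarrow> 0 < p \<Longrightarrow> 0 \<le> legendre_Ir nu p"
  unfolding legendre_Ir_def
  by (intro integral_nonneg integrable_continuous_real continuous_intros)
     (use legendre_Ir_pos_base[of p] in \<open>force simp: less_imp_le\<close>)+

text \<open>Evenness and \<open>w = 1 - c\<^sup>2\<close> turn the weight into the pure power
  \<open>w powr nu\<close>, so that in a product of two such integrals the weight depends only on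
  the product of the variables.\<close>

lemma nn_integral_legendre_Ir:
  assumes nu: "0 \<le> nu" and p: "0 < p"
  shows "(\<integral>\<^sup>+w. ennreal (w powr nu * ((1 - w) * (1 + p * w)) powr (-1/2)) * indicator {0<..<1} w \<partial>lborel) =
     ennreal (legendre_Ir nu p)"
proof -
  define h where "h c = legendre_weight nu c * (1 + p * (1 - c\<^sup>2)) powr (-1/2)" for c
  define f where "f w = w powr nu * ((1 - w) * (1 + p * w)) powr (-1/2)" for w
  have [measurable]: "h \<in> borel_measurable borel" "f \<in> borel_measurable borel"
    unfolding h_def[abs_def] f_def[abs_def] by measurable
  have h0: "0 \<le> h c" for c by (simp add: h_def)
  have cont: "continuous_on {-1..1} h"
    unfolding h_def[abs_def] using legendre_Ir_pos_base[OF p] by (intro continuous_intros nu) force+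
  have "(h has_integral integral {0..1} h) {0..1}"
    by (intro integrable_integral integrable_continuous_real continuous_on_subset[OF cont]) auto
  from integral_even_real[OF _ this] have "(h has_integral 2 * integral {0..1} h) {-1..1}"
    by (simp add: h_def)
  hence I: "legendre_Ir nu p = 2 * integral {0..1} h"
    unfolding legendre_Ir_def h_def[abs_def, symmetric] by (rule integral_unique)
  have "(h has_integral integral {0..1} h) {0<..<1}"
    using \<open>(h has_integral integral {0..1} h) {0..1}\<close> by (simp add: has_integral_Icc_iff_Ioo)
  hence "(\<integral>\<^sup>+c. ennreal (2 * h c) * indicator {0<..<1} c \<partial>lborel) = ennreal (2 * integral {0..1} h)"
    by (intro nn_integral_has_integral_lebesgue' has_integral_mult_right) (simp add: h0)
  hence I2: "(\<integral>\<^sup>+c. ennreal (2 * h c) * indicator {0<..<1} c \<partial>lborel) = ennreal (legendre_Ir nu p)"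
    unfolding I .
  have im: "(\<lambda>c::real. 1 - c\<^sup>2) ` {0<..<1} = {0<..<1}"
  proof (intro equalityI subsetI)
    fix x :: real assume "x \<in> {0<..<1}"
    thus "x \<in> (\<lambda>c::real. 1 - c\<^sup>2) ` {0<..<1}" by (intro image_eqI[of _ _ "sqrt (1 - x)"]) auto
  qed (auto simp: abs_square_less_1 power_less_one_iff)
  have "(\<integral>\<^sup>+w. ennreal (f w) * indicator ((\<lambda>c::real. 1 - c\<^sup>2) ` {0<..<1}) w \<partial>lborel) =
        (\<integral>\<^sup>+c. ennreal (\<bar>- 2 * c\<bar> * f (1 - c\<^sup>2)) * indicator {0<..<1} c \<partial>lborel)"
    by (rule nn_integral_change_of_variables_1)
       (auto simp: im f_def power2_eq_iff intro!: derivative_eq_intros inj_onI)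
  also have "\<dots> = (\<integral>\<^sup>+c. ennreal (2 * h c) * indicator {0<..<1} c \<partial>lborel)"
  proof (rule nn_integral_cong)
    fix c :: real
    show "ennreal (\<bar>- 2 * c\<bar> * f (1 - c\<^sup>2)) * indicator {0<..<1} c = ennreal (2 * h c) * indicator {0<..<1} c"
    proof (cases "c \<in> {0<..<1}")
      case True
      hence "0 < 1 + p * (1 - c\<^sup>2)" using legendre_Ir_pos_base[OF p, of c] by simp
      hence "f (1 - c\<^sup>2) = (1 - c\<^sup>2) powr nu * (c\<^sup>2 powr (-1/2) * (1 + p * (1 - c\<^sup>2)) powr (-1/2))"
        by (simp add: f_def powr_mult)
      also have "c\<^sup>2 powr (-1/2) = 1 / c" using True by (intro square_powr_minus_half) auto
      finally have "\<bar>- 2 * c\<bar> * f (1 - c\<^sup>2) = 2 * h c"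
        using True by (simp add: h_def legendre_weight_eq_powr)
      thus ?thesis by simp
    qed simp
  qed
  finally show ?thesis unfolding I2 im f_def .
qed

text \<open>\<open>N\<close> is the product of the two original integration variables and
  \<open>s\<close> the variable of the elliptic substitution. On the imaginary axis \<open>u\<close>
  will be \<open>1 - x\<^sup>2\<close>.\<close>

definition product_kernel :: "real \<Rightarrow> real \<Rightarrow> real \<times> real \<Rightarrow> real" where
  "product_kernel nu u = (\<lambda>(N, s). indicator {0<..<1} N * indicator {0<..} s *
     (N powr nu * (2 * ((1 + s\<^sup>2) * ((1 - N)\<^sup>2 + 4 * u * N * (1 + s\<^sup>2))) powr (-1/2))))"

lemma product_kernel_nonneg [simp]: "0 \<le> product_kernel nu u x"
  by (auto simp: product_kernel_def split: prod.split)

lemma product_kernel_measurable [measurable]: "product_kernel nu u \<in> borel_measurable (lborel \<Otimes>\<^sub>M lborel)"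
  unfolding product_kernel_def by measurable

text \<open>Write the product as a double integral in \<open>w\<close> and \<open>v\<close>, replace
  \<open>v\<close> by \<open>N = w * v\<close> and exchange the order by Tonelli. The inner integral
  over \<open>w\<close> is then elliptic, and its substitution leaves a dependence on
  \<open>p\<close> through \<open>u\<close> alone. Finiteness of the product gives
  integrability.\<close>

lemma legendre_Ir_product:
  assumes nu: "0 \<le> nu" and p: "0 < p"
  defines "u \<equiv> (1 + p)\<^sup>2 / (4 * p)"
  shows "integrable (lborel \<Otimes>\<^sub>M lborel) (product_kernel nu u)"
    and "(\<integral>x. product_kernel nu u x \<partial>(lborel \<Otimes>\<^sub>M lborel)) = legendre_Ir nu p * legendre_Ir nu (1 / p)"
proof -
  define A where "A q w = ennreal (w powr nu * ((1 - w) * (1 + q * w)) powr (-1/2)) * indicator {0<..<1} w" for q w :: real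
  define E where "E N w = ennreal (((1 - w) * (1 + p * w) * (w - N) * (w + N / p)) powr (-1/2)) * indicator {N<..<1} w" for N w :: real
  have [measurable]: "A q \<in> borel_measurable borel" for q unfolding A_def[abs_def] by measurable
  have Ai: "(\<integral>\<^sup>+w. A q w \<partial>lborel) = ennreal (legendre_Ir nu q)" if "0 < q" for q
    unfolding A_def by (rule nn_integral_legendre_Ir[OF nu that])
  have pt: "ennreal (1 / w) * (A p w * A (1 / p) (N / w)) = ennreal (N powr nu) * indicator {0<..<1} N * E N w" (is "?l = ?r") for N w
  proof (cases "0 < N \<and> N < w \<and> w < 1")
    case True
    hence w: "0 < w" "w < 1" "0 < N" "N < w" "N < 1" by auto
    \<comment> \<open>With \<open>v = N / w\<close>, the Jacobian \<open>1 / w\<close> enters the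
      root as \<open>w\<^sup>2\<close> and clears the denominators. The two supports combine to
      \<open>0 < N < w < 1\<close>.\<close>
    have *: "(1 - w) * (1 + p * w) * (w - N) * (w + N / p) = w\<^sup>2 * (((1 - w) * (1 + p * w)) * ((1 - N / w) * (1 + 1 / p * (N / w))))"
      using w p by (simp add: field_simps power2_eq_square)
    have a: "0 \<le> (1 - w) * (1 + p * w)" "0 \<le> (1 - N / w) * (1 + 1 / p * (N / w))" using w p by auto
    have "((1 - w) * (1 + p * w) * (w - N) * (w + N / p)) powr (-1/2) =
       1 / w * (((1 - w) * (1 + p * w)) powr (-1/2) * ((1 - N / w) * (1 + 1 / p * (N / w))) powr (-1/2))"
      unfolding * using a w by (simp only: powr_mult zero_le_power2 mult_nonneg_nonneg square_powr_minus_half)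
    moreover have "w powr nu * (N / w) powr nu = N powr nu" using w by (simp add: powr_divide)
    ultimately have "1 / w * ((w powr nu * ((1 - w) * (1 + p * w)) powr (-1/2)) * ((N / w) powr nu * ((1 - N / w) * (1 + 1 / p * (N / w))) powr (-1/2))) =
       N powr nu * ((1 - w) * (1 + p * w) * (w - N) * (w + N / p)) powr (-1/2)"
      by (simp add: mult_ac)
    moreover have "?l = ennreal (1 / w * ((w powr nu * ((1 - w) * (1 + p * w)) powr (-1/2)) * ((N / w) powr nu * ((1 - N / w) * (1 + 1 / p * (N / w))) powr (-1/2))))"
      using w by (simp add: A_def ennreal_mult'[symmetric] del: times_divide_eq_left times_divide_eq_right)
    ultimately show ?thesis using w by (simp add: E_def ennreal_mult')
  next
    case False
    thus ?thesis by (auto simp: A_def E_def indicator_def field_simps)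
  qed
  have "ennreal (legendre_Ir nu p * legendre_Ir nu (1 / p)) = (\<integral>\<^sup>+w. A p w \<partial>lborel) * (\<integral>\<^sup>+w. A (1 / p) w \<partial>lborel)"
    using p legendre_Ir_nonneg[OF nu, of p] by (simp add: Ai ennreal_mult')
  also have "\<dots> = (\<integral>\<^sup>+w. A p w * (\<integral>\<^sup>+v. A (1 / p) v \<partial>lborel) \<partial>lborel)"
    by (rule nn_integral_multc[symmetric]) simp
  also have "\<dots> = (\<integral>\<^sup>+w. (\<integral>\<^sup>+N. ennreal (1 / w) * (A p w * A (1 / p) (N / w)) \<partial>lborel) \<partial>lborel)"
  proof (rule nn_integral_cong)
    fix w :: real
    show "A p w * (\<integral>\<^sup>+v. A (1 / p) v \<partial>lborel) = (\<integral>\<^sup>+N. ennreal (1 / w) * (A p w * A (1 / p) (N / w)) \<partial>lborel)"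
    proof (cases "0 < w")
      case True
      have "(\<integral>\<^sup>+v. A (1 / p) v \<partial>lborel) = ennreal (1 / w) * (\<integral>\<^sup>+N. A (1 / p) (N / w) \<partial>lborel)"
        using nn_integral_real_affine[of "A (1 / p)" "1 / w" 0] True by simp
      thus ?thesis by (simp add: nn_integral_cmult mult_ac)
    qed (simp add: A_def)
  qed
  also have "\<dots> = (\<integral>\<^sup>+N. (\<integral>\<^sup>+w. ennreal (1 / w) * (A p w * A (1 / p) (N / w)) \<partial>lborel) \<partial>lborel)"
    by (rule lborel_pair.Fubini'[symmetric]) (simp add: A_def case_prod_unfold)
  also have "\<dots> = (\<integral>\<^sup>+N. (\<integral>\<^sup>+s. ennreal (product_kernel nu u (N, s)) \<partial>lborel) \<partial>lborel)"
  proof (rule nn_integral_cong)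
    fix N :: real
    have "(\<integral>\<^sup>+w. ennreal (1 / w) * (A p w * A (1 / p) (N / w)) \<partial>lborel) = ennreal (N powr nu) * indicator {0<..<1} N * (\<integral>\<^sup>+w. E N w \<partial>lborel)"
      unfolding pt by (rule nn_integral_cmult) (simp add: E_def)
    also have "\<dots> = (\<integral>\<^sup>+s. ennreal (product_kernel nu u (N, s)) \<partial>lborel)"
    proof (cases "0 < N \<and> N < 1")
      case True
      have "(\<integral>\<^sup>+w. E N w \<partial>lborel) = (\<integral>\<^sup>+s. ennreal (2 * ((1 + s\<^sup>2) * ((1 - N)\<^sup>2 + 4 * u * N * (1 + s\<^sup>2))) powr (-1/2)) * indicator {0<..} s \<partial>lborel)"
        unfolding E_def u_def by (rule elliptic_substitution) (use p True in auto)
      hence "ennreal (N powr nu) * indicator {0<..<1} N * (\<integral>\<^sup>+w. E N w \<partial>lborel) =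
        (\<integral>\<^sup>+s. ennreal (N powr nu) * (ennreal (2 * ((1 + s\<^sup>2) * ((1 - N)\<^sup>2 + 4 * u * N * (1 + s\<^sup>2))) powr (-1/2)) * indicator {0<..} s) \<partial>lborel)"
        using True by (simp add: nn_integral_cmult)
      also have "\<dots> = (\<integral>\<^sup>+s. ennreal (product_kernel nu u (N, s)) \<partial>lborel)"
        using True by (intro nn_integral_cong) (auto simp: product_kernel_def ennreal_mult' indicator_def)
      finally show ?thesis .
    qed (auto simp: product_kernel_def)
    finally show "(\<integral>\<^sup>+w. ennreal (1 / w) * (A p w * A (1 / p) (N / w)) \<partial>lborel) = (\<integral>\<^sup>+s. ennreal (product_kernel nu u (N, s)) \<partial>lborel)" .
  qed
  also have "\<dots> = (\<integral>\<^sup>+x. ennreal (product_kernel nu u x) \<partial>(lborel \<Otimes>\<^sub>M lborel))"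
    by (rule lborel.nn_integral_fst) simp
  finally have *: "(\<integral>\<^sup>+x. ennreal (product_kernel nu u x) \<partial>(lborel \<Otimes>\<^sub>M lborel)) = ennreal (legendre_Ir nu p * legendre_Ir nu (1 / p))" ..
  have "0 \<le> legendre_Ir nu p * legendre_Ir nu (1 / p)"
    using p by (intro mult_nonneg_nonneg legendre_Ir_nonneg nu) auto
  with * show "integrable (lborel \<Otimes>\<^sub>M lborel) (product_kernel nu u)"
    and "(\<integral>x. product_kernel nu u x \<partial>(lborel \<Otimes>\<^sub>M lborel)) = legendre_Ir nu p * legendre_Ir nu (1 / p)"
    by (subst (asm) nn_integral_eq_integrable; simp)+
qed

subsection \<open>Absolute and complete monotonicity\<close>

text \<open>The share of the \<open>u\<close>-dependent term in the second factor of the radicand at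
  \<open>u = 1\<close>. The indicator keeps it within \<open>[0, 1]\<close> on the whole plane, as
  the binomial expansion requires.\<close>

definition kernel_ratio :: "real \<times> real \<Rightarrow> real" where
  "kernel_ratio = (\<lambda>(N, s). indicator {0<..} N * (4 * N * (1 + s\<^sup>2) / ((1 - N)\<^sup>2 + 4 * N * (1 + s\<^sup>2))))"

lemma kernel_ratio_measurable [measurable]: "kernel_ratio \<in> borel_measurable (lborel \<Otimes>\<^sub>M lborel)"
  unfolding kernel_ratio_def by measurable

lemma kernel_ratio_bounds: "0 \<le> kernel_ratio x" "kernel_ratio x \<le> 1"
proof -
  obtain N s where x: "x = (N, s)" by (cases x)
  have "0 < 4 * N * (1 + s\<^sup>2)" "0 < (1 - N)\<^sup>2 + 4 * N * (1 + s\<^sup>2)" if "0 < N"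
    using that by (intro mult_pos_pos add_pos_nonneg add_nonneg_pos; simp)+
  thus "0 \<le> kernel_ratio x" "kernel_ratio x \<le> 1"
    by (cases "0 < N"; simp add: x kernel_ratio_def)+
qed

text \<open>With \<open>A = (1 - N)\<^sup>2 + B\<close> and
  \<open>B = 4 * N * (1 + s\<^sup>2)\<close>, lowering \<open>u\<close> from \<open>1\<close> to
  \<open>1 - v\<close> replaces \<open>A\<close> by
  \<open>A - v * B = A * (1 - v * (B / A))\<close>.\<close>

lemma product_kernel_binomial:
  assumes "\<bar>v\<bar> < 1"
  shows "product_kernel nu 1 x * (1 - v * kernel_ratio x) powr (-(1/2)) = product_kernel nu (1 - v) x"
proof -
  obtain N s where x: "x = (N, s)" by (cases x)
  show ?thesis
  proof (cases "N \<in> {0<..<1} \<and> 0 < s")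
    case True
    hence N: "0 < N" "N < 1" by auto
    define B where "B = 4 * N * (1 + s\<^sup>2)"
    define A where "A = (1 - N)\<^sup>2 + B"
    have B: "0 < B" unfolding B_def using N by (intro mult_pos_pos add_pos_nonneg) auto
    have A: "0 < A" unfolding A_def using B by (intro add_nonneg_pos) auto
    have r: "kernel_ratio x = B / A" using N by (simp add: x kernel_ratio_def A_def B_def)
    have "\<bar>v * kernel_ratio x\<bar> \<le> 1 * 1"
      unfolding abs_mult using assms kernel_ratio_bounds[of x] by (intro mult_mono) auto
    hence z: "0 \<le> 1 - v * kernel_ratio x" by simp
    have "((1 + s\<^sup>2) * A) powr (-(1/2)) * (1 - v * kernel_ratio x) powr (-(1/2)) =
       ((1 + s\<^sup>2) * A * (1 - v * kernel_ratio x)) powr (-(1/2))"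
      by (rule powr_mult[symmetric])
    also have "(1 + s\<^sup>2) * A * (1 - v * kernel_ratio x) = (1 + s\<^sup>2) * (A * (1 - v * (B / A)))"
      unfolding r by simp
    also have "A * (1 - v * (B / A)) = (1 - N)\<^sup>2 + 4 * (1 - v) * N * (1 + s\<^sup>2)"
      using A by (simp add: A_def B_def field_simps)
    finally show ?thesis
      using True by (simp add: x product_kernel_def A_def B_def mult_ac)
  qed (auto simp: x product_kernel_def)
qed

definition product_coeff :: "real \<Rightarrow> nat \<Rightarrow> real" where
  "product_coeff nu n = pochhammer (1/2) n / fact n *
     (\<integral>x. product_kernel nu 1 x * kernel_ratio x ^ n \<partial>(lborel \<Otimes>\<^sub>M lborel))"

lemma product_coeff_nonneg: "0 \<le> product_coeff nu n"
proof -
  have "0 \<le> (\<integral>x. product_kernel nu 1 x * kernel_ratio x ^ n \<partial>(lborel \<Otimes>\<^sub>M lborel))"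
    by (rule Bochner_Integration.integral_nonneg) (simp add: kernel_ratio_bounds)
  thus ?thesis by (simp add: product_coeff_def pochhammer_nonneg_real)
qed

lemma product_coeff_sums:
  assumes nu: "0 \<le> nu" and v: "\<bar>v\<bar> < 1"
  shows "(\<lambda>n. product_coeff nu n * v ^ n) sums (\<integral>x. product_kernel nu (1 - v) x \<partial>(lborel \<Otimes>\<^sub>M lborel))"
proof -
  \<comment> \<open>The case \<open>p = 1\<close> of the product formula, where
    \<open>u = 1\<close>.\<close>
  have "integrable (lborel \<Otimes>\<^sub>M lborel) (product_kernel nu 1)"
    using legendre_Ir_product(1)[OF nu, of 1] by simp
  hence "(\<lambda>n. pochhammer (1/2) n / fact n * (\<integral>x. product_kernel nu 1 x * kernel_ratio x ^ n \<partial>(lborel \<Otimes>\<^sub>M lborel)) * v ^ n)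
      sums (\<integral>x. product_kernel nu 1 x * (1 - v * kernel_ratio x) powr (-(1/2)) \<partial>(lborel \<Otimes>\<^sub>M lborel))"
    by (intro binomial_integral_sums) (use v in \<open>auto simp: kernel_ratio_bounds\<close>)
  thus ?thesis by (simp only: product_coeff_def product_kernel_binomial[OF v])
qed

text \<open>At \<open>x = \<i> * t\<close> the roots are \<open>- \<i> * r\<close> and
  \<open>\<i> / r\<close> with \<open>r = sqrt (1 + t\<^sup>2) - t\<close>. Their squares are
  \<open>- p\<close> and \<open>- (1 / p)\<close>, so the product formula applies, with
  \<open>u = 1 + t\<^sup>2 = 1 - x\<^sup>2\<close>.\<close>

lemma legendre_G_imaginary:
  assumes nu: "0 \<le> nu" and t: "0 < t" "t < 1"
  shows "(\<lambda>n. of_real (product_coeff nu n) * ((\<i> * of_real t)\<^sup>2) ^ n) sums legendre_G nu (\<i> * of_real t)"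
proof -
  define q where "q = sqrt (1 + t\<^sup>2)"
  define r where "r = q - t"
  define p where "p = r\<^sup>2"
  have q2: "q\<^sup>2 = 1 + t\<^sup>2" by (simp add: q_def add_nonneg_nonneg)
  have "t < q" unfolding q_def by (rule real_less_rsqrt) simp
  hence r: "0 < r" by (simp add: r_def)
  have rq: "r * (q + t) = 1" using q2 by (simp add: r_def power2_eq_square algebra_simps)
  have p: "0 < p" using r by (simp add: p_def)
  have ip: "(q + t)\<^sup>2 = 1 / p"
    using rq r by (simp add: p_def field_simps flip: power_mult_distrib)
  have "1 + p = r * (2 * q)" unfolding rq[symmetric] p_def by (simp add: r_def power2_eq_square algebra_simps)
  hence "(1 + p)\<^sup>2 = 4 * p * (1 + t\<^sup>2)" by (simp add: power_mult_distrib q2 p_def)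
  hence u: "(1 + p)\<^sup>2 / (4 * p) = 1 - (- t\<^sup>2)" using p by simp
  have cs: "csqrt (1 - (\<i> * of_real t)\<^sup>2) = of_real q"
    unfolding q_def by (subst of_real_sqrt) (auto simp: power_mult_distrib)
  have e1: "(\<i> * of_real t - \<i> * of_real q)\<^sup>2 = of_real (- p)"
    by (simp add: p_def r_def power2_eq_square algebra_simps)
  have e2: "(\<i> * of_real t + \<i> * of_real q)\<^sup>2 = of_real (- (1 / p))"
    unfolding ip[symmetric] by (simp add: power2_eq_square algebra_simps)
  have e3: "legendre_I nu (of_real (- k)) = of_real (legendre_Ir nu k)" if "0 < k" for k
    using that by (subst legendre_I_of_real) (auto simp: legendre_Ir_def)
  have "0 < 1 / p" using p by simp
  have "legendre_G nu (\<i> * of_real t) = of_real (legendre_Ir nu p * legendre_Ir nu (1 / p))"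
    unfolding legendre_G_def cs e1 e2 e3[OF p] e3[OF \<open>0 < 1 / p\<close>] by simp
  moreover have "(\<lambda>n. product_coeff nu n * (- t\<^sup>2) ^ n) sums (legendre_Ir nu p * legendre_Ir nu (1 / p))"
    using product_coeff_sums[OF nu, of "- t\<^sup>2"] t legendre_Ir_product(2)[OF nu p] unfolding u
    by (simp add: abs_square_less_1)
  hence "(\<lambda>n. complex_of_real (product_coeff nu n * (- t\<^sup>2) ^ n)) sums of_real (legendre_Ir nu p * legendre_Ir nu (1 / p))"
    by (rule sums_of_real)
  moreover have "(\<i> * of_real t)\<^sup>2 = complex_of_real (- t\<^sup>2)" by (simp add: power_mult_distrib)
  ultimately show ?thesis by (simp only: of_real_mult of_real_power)
qed

text \<open>Both sides are holomorphic in the unit disc and agree on a segment of the imaginary axis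
  that accumulates at \<open>0\<close>, so the nonnegative coefficients found there also serve on
  the real axis.\<close>

lemma legendre_G_sums:
  assumes nu: "0 \<le> nu" and x: "cmod x < 1"
  shows "(\<lambda>n. of_real (product_coeff nu n) * (x\<^sup>2) ^ n) sums legendre_G nu x"
proof -
  define F where "F w = (\<Sum>n. complex_of_real (product_coeff nu n) * w ^ n)" for w
  have sF: "(\<lambda>n. complex_of_real (product_coeff nu n) * w ^ n) sums F w" if "cmod w < 1" for w
  proof -
    \<comment> \<open>Nonnegative coefficients reduce absolute convergence at \<open>w\<close> to
      the real series at \<open>cmod w\<close>.\<close>
    have "summable (\<lambda>n. product_coeff nu n * cmod w ^ n)"
      using product_coeff_sums[OF nu, of "cmod w"] that by (auto simp: sums_iff)
    hence "summable (\<lambda>n. norm (complex_of_real (product_coeff nu n) * w ^ n))"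
      using product_coeff_nonneg[of nu] by (simp add: norm_mult norm_power)
    thus ?thesis unfolding F_def by (intro summable_sums[OF summable_norm_cancel])
  qed
  have sq: "cmod (w\<^sup>2) < 1" if "cmod w < 1" for w
    using that by (simp add: norm_power abs_square_less_1)
  have "F holomorphic_on ball 0 1"
  proof (rule power_series_holomorphic)
    fix w :: complex assume "w \<in> ball 0 1"
    thus "(\<lambda>n. complex_of_real (product_coeff nu n) * (w - 0) ^ n) sums F w" using sF[of w] by simp
  qed
  hence "(F \<circ> (\<lambda>x. x\<^sup>2)) holomorphic_on ball 0 1"
    by (rule holomorphic_on_compose_gen[rotated]) (use sq in \<open>auto intro!: holomorphic_intros\<close>)
  hence hol: "(\<lambda>x. legendre_G nu x - F (x\<^sup>2)) holomorphic_on ball 0 1"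
    by (intro holomorphic_on_diff legendre_G_holomorphic[OF nu]) (simp add: o_def)
  have "legendre_G nu x - F (x\<^sup>2) = 0"
  proof (rule analytic_continuation[OF hol, of "(\<lambda>t. \<i> * of_real t) ` {0<..<1}" 0])
    show "0 islimpt (\<lambda>t. \<i> * complex_of_real t) ` {0<..<1}"
      unfolding islimpt_approachable
    proof (intro allI impI)
      fix e :: real assume "0 < e"
      thus "\<exists>x'\<in>(\<lambda>t. \<i> * complex_of_real t) ` {0<..<1}. x' \<noteq> 0 \<and> dist x' 0 < e"
        by (intro bexI[of _ "\<i> * of_real (min (e/2) (1/2))"] conjI imageI) (auto simp: norm_mult min_def)
    qed
    fix z assume "z \<in> (\<lambda>t. \<i> * complex_of_real t) ` {0<..<1}"
    then obtain t where t: "0 < t" "t < 1" "z = \<i> * of_real t" by auto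
    have "cmod z < 1" using t by (simp add: norm_mult)
    from sF[OF sq[OF this]] legendre_G_imaginary[OF nu t(1,2)]
    show "legendre_G nu z - F (z\<^sup>2) = 0" unfolding t(3) by (simp add: sums_iff)
  qed (use x in \<open>auto simp: norm_mult\<close>)
  thus ?thesis using sF[OF sq[OF x]] by simp
qed

lemma absolutely_monotone_norm_legendre_Q:
  assumes nu: "0 \<le> nu"
  shows "absolutely_monotone_on {0<..<1} (\<lambda>x. (cmod (legendre_Q nu (of_real x)))\<^sup>2)"
proof -
  define f where "f x = (cmod (legendre_Q nu (of_real x)))\<^sup>2" for x
  \<comment> \<open>The series in \<open>x\<^sup>2\<close> is interleaved with zeros to make it a
    power series in \<open>x\<close>.\<close>
  define d where "d m = (if even m then product_coeff nu (m div 2) else 0)" for m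
  have "(\<lambda>m. d m * x ^ m) sums f x" if x: "0 < x" "x < 1" for x
  proof -
    have "(\<lambda>n. of_real (product_coeff nu n) * ((complex_of_real x)\<^sup>2) ^ n) sums complex_of_real (f x)"
      using legendre_G_sums[OF nu, of "of_real x"] x norm_legendre_Q_unit[OF nu x] by (simp add: f_def)
    hence "(\<lambda>n. complex_of_real (product_coeff nu n * x ^ (2 * n))) sums complex_of_real (f x)"
      by (simp add: power_mult)
    hence "(\<lambda>n. product_coeff nu n * x ^ (2 * n)) sums f x" by (simp only: sums_of_real_iff)
    hence "(\<lambda>n. d (2 * n) * x ^ (2 * n)) sums f x" by (simp add: d_def)
    thus ?thesis
      by (subst (asm) sums_mono_reindex[of "\<lambda>n. 2 * n" "\<lambda>m. d m * x ^ m"])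
         (auto simp: strict_mono_def d_def elim!: evenE)
  qed
  hence "(deriv ^^ k) f differentiable (at x) \<and> 0 \<le> 1 * 1 ^ k * (deriv ^^ k) f x" if "x \<in> {0<..<1}" for k x
    using that by (intro deriv_sign_of_power_series[where a = d and b = 0 and R = 1 and e = 1 and d = 1])
       (auto simp: d_def product_coeff_nonneg)
  thus ?thesis unfolding absolutely_monotone_on_def f_def[abs_def, symmetric] by simp
qed

text \<open>From \<open>x + s = (b + s) * (1 - (b - x) / (b + s))\<close> the binomial series
  expands in \<open>b - x\<close>. The factor \<open>b - 1\<close> moved between \<open>t\<close>
  and \<open>X\<close> ensures \<open>X \<le> 1\<close>, because \<open>s \<ge> -1\<close>, and
  \<open>t < 1\<close>, because \<open>x > 1\<close>.\<close>

lemma legendre_Q_power_series_gt_1: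
  assumes nu: "0 \<le> nu" and b: "1 < b"
  obtains a where "\<And>n. 0 \<le> a n"
    "\<And>x. 1 < x \<Longrightarrow> x < b \<Longrightarrow> (\<lambda>n. a n * (b - x) ^ n) sums
        integral {-1..1} (\<lambda>s. legendre_weight nu s * (2 * (x + s)) powr (- (nu + 1)))"
proof -
  define g where "g s = indicator {-1..1} s * legendre_weight nu s * (2 * (b + s)) powr (- (nu + 1))" for s
  define X where "X s = indicator {-1..1} s * ((b - 1) / (b + s))" for s
  define c where "c n = pochhammer (nu + 1) n / fact n * (\<integral>s. g s * X s ^ n \<partial>lborel)" for n
  have X: "0 \<le> X s" "X s \<le> 1" for s using b by (auto simp: X_def indicator_def)
  have [measurable]: "X \<in> borel_measurable lborel" unfolding X_def[abs_def] by measurable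
  have co: "continuous_on {-1..1} (\<lambda>s. (2 * (y + s)) powr (- (nu + 1)))" if "1 < y" for y
    using that by (intro continuous_intros) auto
  have int: "integrable lborel g"
    using integrable_legendre_weight[OF nu co[OF b]] by (simp add: g_def[abs_def])
  have g0: "0 \<le> g s" for s by (simp add: g_def)
  show thesis
  proof (rule that[of "\<lambda>n. c n / (b - 1) ^ n"])
    show "0 \<le> c n / (b - 1) ^ n" for n
      unfolding c_def using b nu X g0
      by (intro divide_nonneg_nonneg mult_nonneg_nonneg Bochner_Integration.integral_nonneg zero_le_power)
         (auto simp: pochhammer_nonneg_real)
    fix x assume x: "1 < x" "x < b"
    define t where "t = (b - x) / (b - 1)"
    have t: "\<bar>t\<bar> < 1" using x b by (simp add: t_def)
    have "(\<lambda>n. c n * t ^ n) sums (\<integral>s. g s * (1 - t * X s) powr (- (nu + 1)) \<partial>lborel)"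
      unfolding c_def by (rule binomial_integral_sums) (use int g0 X nu t in auto)
    also have "(\<lambda>s. g s * (1 - t * X s) powr (- (nu + 1))) = (\<lambda>s. (indicator {-1..1} s * legendre_weight nu s) *\<^sub>R (2 * (x + s)) powr (- (nu + 1)))"
    proof
      fix s
      show "g s * (1 - t * X s) powr (- (nu + 1)) = (indicator {-1..1} s * legendre_weight nu s) *\<^sub>R (2 * (x + s)) powr (- (nu + 1))"
      proof (cases "s \<in> {-1..1}")
        case True
        have "t * X s = (b - x) / (b + s)" using True b by (simp add: t_def X_def)
        hence "1 - t * X s = (x + s) / (b + s)" using True b by (simp add: field_simps)
        moreover have "(2 * (b + s)) powr (- (nu + 1)) * ((x + s) / (b + s)) powr (- (nu + 1)) = (2 * (x + s)) powr (- (nu + 1))"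
        proof -
          have "b + s \<noteq> 0" using True b by simp
          hence "(2 * (b + s)) * ((x + s) / (b + s)) = 2 * (x + s)" by (simp add: field_simps)
          thus ?thesis by (simp only: powr_mult[symmetric])
        qed
        ultimately show ?thesis using True by (simp add: g_def mult.assoc)
      qed (simp add: g_def)
    qed
    also have "(\<integral>s. (indicator {-1..1} s * legendre_weight nu s) *\<^sub>R (2 * (x + s)) powr (- (nu + 1)) \<partial>lborel) =
        integral {-1..1} (\<lambda>s. legendre_weight nu s * (2 * (x + s)) powr (- (nu + 1)))"
      using integral_legendre_weight[OF nu co[OF x(1)]] by simp
    finally show "(\<lambda>n. c n / (b - 1) ^ n * (b - x) ^ n) sums
        integral {-1..1} (\<lambda>s. legendre_weight nu s * (2 * (x + s)) powr (- (nu + 1)))"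
      by (simp add: t_def power_divide)
  qed
qed

text \<open>Beyond \<open>1\<close> the function is real, so its squared modulus is a plain square,
  and the Cauchy product keeps the coefficients nonnegative.\<close>

lemma completely_monotone_norm_legendre_Q:
  assumes nu: "0 \<le> nu"
  shows "completely_monotone_on {1<..} (\<lambda>x. (cmod (legendre_Q nu (of_real x)))\<^sup>2)"
proof -
  define f where "f x = (cmod (legendre_Q nu (of_real x)))\<^sup>2" for x
  define q where "q x = integral {-1..1} (\<lambda>s. legendre_weight nu s * (2 * (x + s)) powr (- (nu + 1)))" for x
  have fq: "f x = q x * q x" if "1 < x" for x
    by (simp add: f_def legendre_Q_gt_1[OF nu that] q_def power2_eq_square)
  have "(deriv ^^ k) f differentiable (at x) \<and> 0 \<le> 1 * (-1) ^ k * (deriv ^^ k) f x" if x: "1 < x" for k x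
  proof -
    \<comment> \<open>The centre of expansion must lie to the right of \<open>x\<close>; the series
      in \<open>b - y\<close> then holds for \<open>1 < y < b\<close>, that is, with radius
      \<open>b - 1\<close>.\<close>
    define b where "b = x + 1"
    have b: "1 < b" using x by (simp add: b_def)
    obtain a where a: "\<And>n. 0 \<le> a n" "\<And>y. 1 < y \<Longrightarrow> y < b \<Longrightarrow> (\<lambda>n. a n * (b - y) ^ n) sums q y"
      using legendre_Q_power_series_gt_1[OF nu b] unfolding q_def by blast
    define d where "d n = (\<Sum>i\<le>n. a i * a (n - i))" for n
    have "(\<lambda>n. d n * (b - y) ^ n) sums f y" if y: "1 < y" "y < b" for y
    proof -
      have nn: "norm (a n * (b - y) ^ n) = a n * (b - y) ^ n" for n
        using a(1) y by (simp add: abs_mult)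
      have "(\<lambda>n. \<Sum>i\<le>n. (a i * (b - y) ^ i) * (a (n - i) * (b - y) ^ (n - i))) sums
         ((\<Sum>n. a n * (b - y) ^ n) * (\<Sum>n. a n * (b - y) ^ n))"
        using a(2)[OF y] by (intro Cauchy_product_sums) (auto simp only: nn sums_iff)
      also have "(\<Sum>n. a n * (b - y) ^ n) = q y" using a(2)[OF y] by (simp add: sums_iff)
      also have "(\<lambda>n. \<Sum>i\<le>n. (a i * (b - y) ^ i) * (a (n - i) * (b - y) ^ (n - i))) = (\<lambda>n. d n * (b - y) ^ n)"
      proof
        fix n
        have "(\<Sum>i\<le>n. (a i * (b - y) ^ i) * (a (n - i) * (b - y) ^ (n - i))) = (\<Sum>i\<le>n. a i * a (n - i) * (b - y) ^ n)"
          by (intro sum.cong refl) (simp add: mult_ac flip: power_add)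
        thus "(\<Sum>i\<le>n. (a i * (b - y) ^ i) * (a (n - i) * (b - y) ^ (n - i))) = d n * (b - y) ^ n"
          by (simp add: d_def sum_distrib_right)
      qed
      finally show ?thesis using fq[OF y(1)] by simp
    qed
    moreover have "0 \<le> d n" for n unfolding d_def by (intro sum_nonneg mult_nonneg_nonneg a)
    ultimately show ?thesis
      by (intro deriv_sign_of_power_series[where a = d and b = b and R = "b - 1" and e = "-1" and d = 1])
         (use x in \<open>auto simp: b_def\<close>)
  qed
  thus ?thesis unfolding completely_monotone_on_def f_def[abs_def, symmetric] by simp
qed

theorem theorem1:
  fixes nu :: real
  assumes "nu \<ge> 0"
  shows "absolutely_monotone_on {0<..<1} (\<lambda>x. (cmod (legendre_Q nu (of_real x)))\<^sup>2)
       \<and> completely_monotone_on {1<..} (\<lambda>x. (cmod (legendre_Q nu (of_real x)))\<^sup>2)"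
  using absolutely_monotone_norm_legendre_Q[OF assms] completely_monotone_norm_legendre_Q[OF assms] by blast

end
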